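(* Let $\Omega\subset\mathbb{R}^N$, $N\ge1$, be a bounded open set and let $a:\Omega\times\mathbb{R}\times\mathbb{R}^N\to\mathbb{R}^N$ be a Carathéodory function satisfying $|a(x,s,\xi)|\leq\beta(1+|\xi|)$ for some $\beta>0$, for all $(s,\xi)\in\mathbb{R}\times\mathbb{R}^N$ and a.e. $x\in\Omega$. Let $p>2$, $\lambda>0$, and let $f\in L^q_{\rm loc}(\Omega)$ for some $q\ge1$ with $q>\frac Np$. Let $u\in W^{1,p}_{\rm loc}(\Omega)$ be a subsolution, in the sense of distributions, of $$-\operatorname{div}(a(x,u,\nabla u))+\lambda u+|\nabla u|^p\leq f(x)\qquad\text{in }\Omega.$$ Then $u^+\in L^\infty_{\rm loc}(\Omega)$ and, for every pair of concentric balls $B_\rho\subset B_R\subset\Omega$, $$\|u^+\|_{L^\infty(B_\rho)}\leq K,$$ where $K=K\left(\beta,p,q,N,\lambda^{-1},\rho,R,\|f\|_{L^q(B_R)},\|u^+\|_{L^1(B_R)}\right)$ depends only on the quantities indicated.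
   Context: Carathéodory function: measurable in $x$ for every fixed $(s,\xi)$ and continuous in $(s,\xi)$ for a.e. $x$. $u^+=\max\{u,0\}$. Subsolution in the sense of distributions means that for every $\varphi\in C^\infty_0(\Omega)$ (smooth, compactly supported) with $\varphi\ge0$, $$\int_\Omega a(x,u,\nabla u)\cdot\nabla\varphi\,dx+\lambda\int_\Omega u\,\varphi\,dx+\int_\Omega|\nabla u|^p\varphi\,dx\leq\int_\Omega f\varphi\,dx.$$ $B_\rho$, $B_R$ denote balls with the same center and radii $0<\rho<R$. *)

theory Defs
  imports "HOL-Analysis.Analysis" "HOL-Probability.Essential_Supremum"
begin

section \<open>Lebesgue norms and local Lebesgue spaces\<close>

text \<open>
  The norms take values in \<^typ>\<open>ennreal\<close>, so that they are meaningful (possibly infinite)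
  for every measurable function; \<^term>\<open>p\<close> is a finite exponent, \<^term>\<open>p \<ge> 1\<close>.
\<close>

definition Lp_norm :: "real \<Rightarrow> 'a::euclidean_space set \<Rightarrow> ('a \<Rightarrow> 'b::real_normed_vector) \<Rightarrow> ennreal"
  where "Lp_norm p S f =
    (let I = (\<integral>\<^sup>+ x. ennreal (norm (f x) powr p) \<partial>lebesgue_on S)
     in if I = \<infinity> then \<infinity> else ennreal (enn2real I powr (1 / p)))"

definition Linf_norm :: "'a::euclidean_space set \<Rightarrow> ('a \<Rightarrow> 'b::real_normed_vector) \<Rightarrow> ennreal"
  where "Linf_norm S f = esssup (lebesgue_on S) (\<lambda>x. ennreal (norm (f x)))"

definition Lp_loc :: "real \<Rightarrow> 'a::euclidean_space set \<Rightarrow> ('a \<Rightarrow> 'b::real_normed_vector) set"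
  where "Lp_loc p \<Omega> = {f. f \<in> borel_measurable (lebesgue_on \<Omega>) \<and>
    (\<forall>C. compact C \<and> C \<subseteq> \<Omega> \<longrightarrow> Lp_norm p C f < \<infinity>)}"

definition Linf_loc :: "'a::euclidean_space set \<Rightarrow> ('a \<Rightarrow> 'b::real_normed_vector) set"
  where "Linf_loc \<Omega> = {f. f \<in> borel_measurable (lebesgue_on \<Omega>) \<and>
    (\<forall>C. compact C \<and> C \<subseteq> \<Omega> \<longrightarrow> Linf_norm C f < \<infinity>)}"


section \<open>Test functions\<close>

definition partial_deriv :: "'n::finite \<Rightarrow> (real ^ 'n \<Rightarrow> real) \<Rightarrow> real ^ 'n \<Rightarrow> real"
  where "partial_deriv i f x = frechet_derivative f (at x) (axis i 1)"

definition grad :: "(real ^ 'n \<Rightarrow> real) \<Rightarrow> real ^ 'n \<Rightarrow> real ^ ('n::finite)"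
  where "grad f x = (\<chi> i. partial_deriv i f x)"

primrec Ck :: "nat \<Rightarrow> (real ^ ('n::finite) \<Rightarrow> real) \<Rightarrow> bool"
  where
    "Ck 0 f \<longleftrightarrow> continuous_on UNIV f"
  | "Ck (Suc k) f \<longleftrightarrow> (\<forall>x. f differentiable (at x)) \<and> (\<forall>i. Ck k (partial_deriv i f))"

text \<open>\<open>C\<^sub>0\<^sup>\<infinity>(\<Omega>)\<close>; its elements are extended by zero to the whole space.\<close>

definition test_functions :: "(real ^ ('n::finite)) set \<Rightarrow> (real ^ 'n \<Rightarrow> real) set"
  where "test_functions \<Omega> = {\<phi>. (\<forall>k. Ck k \<phi>) \<and>
    compact (closure {x. \<phi> x \<noteq> 0}) \<and> closure {x. \<phi> x \<noteq> 0} \<subseteq> \<Omega>}"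


section \<open>Weak gradients and local Sobolev spaces\<close>

definition has_weak_gradient ::
    "(real ^ ('n::finite)) set \<Rightarrow> (real ^ 'n \<Rightarrow> real) \<Rightarrow> (real ^ 'n \<Rightarrow> real ^ 'n) \<Rightarrow> bool"
  where "has_weak_gradient \<Omega> u Du \<longleftrightarrow> u \<in> Lp_loc 1 \<Omega> \<and> Du \<in> Lp_loc 1 \<Omega> \<and>
    (\<forall>\<phi>\<in>test_functions \<Omega>.
      (LINT x:\<Omega>|lebesgue. u x *\<^sub>R grad \<phi> x) = - (LINT x:\<Omega>|lebesgue. \<phi> x *\<^sub>R Du x))"

text \<open>
  \<open>u \<in> W\<^sup>1\<^sup>,\<^sup>p\<^sub>l\<^sub>o\<^sub>c(\<Omega>)\<close> with weak gradient \<open>Du\<close>. A weak gradient is unique only up to null sets,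
  so the representative is carried explicitly.
\<close>

definition in_W1p_loc ::
    "real \<Rightarrow> (real ^ ('n::finite)) set \<Rightarrow> (real ^ 'n \<Rightarrow> real) \<Rightarrow> (real ^ 'n \<Rightarrow> real ^ 'n) \<Rightarrow> bool"
  where "in_W1p_loc p \<Omega> u Du \<longleftrightarrow>
    u \<in> Lp_loc p \<Omega> \<and> Du \<in> Lp_loc p \<Omega> \<and> has_weak_gradient \<Omega> u Du"


section \<open>The differential inequality\<close>

definition caratheodory ::
    "(real ^ ('n::finite)) set \<Rightarrow> (real ^ 'n \<Rightarrow> real \<Rightarrow> real ^ 'n \<Rightarrow> real ^ 'n) \<Rightarrow> bool"
  where "caratheodory \<Omega> a \<longleftrightarrow>
    (\<forall>s \<xi>. (\<lambda>x. a x s \<xi>) \<in> borel_measurable (lebesgue_on \<Omega>)) \<and>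
    (AE x in lebesgue_on \<Omega>. continuous_on UNIV (\<lambda>(s, \<xi>). a x s \<xi>))"

text \<open>
  \<open>u\<close>, with weak gradient \<open>Du\<close>, is a subsolution in the sense of distributions of
  \<open>- div (a(x, u, \<nabla>u)) + \<lambda> u + |\<nabla>u|\<^sup>p \<le> f\<close> in \<open>\<Omega>\<close>. All four integrands are integrable
  when \<open>u\<close> belongs to \<open>W\<^sup>1\<^sup>,\<^sup>p\<^sub>l\<^sub>o\<^sub>c(\<Omega>)\<close>, \<open>f\<close> to \<open>L\<^sup>1\<^sub>l\<^sub>o\<^sub>c(\<Omega>)\<close>, and \<open>a\<close> is a Caratheodory
  function of linear growth in the gradient.
\<close>

definition distr_subsolution ::
    "(real ^ ('n::finite)) set \<Rightarrow> (real ^ 'n \<Rightarrow> real \<Rightarrow> real ^ 'n \<Rightarrow> real ^ 'n) \<Rightarrow> real \<Rightarrow> real \<Rightarrow>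
     (real ^ 'n \<Rightarrow> real) \<Rightarrow> (real ^ 'n \<Rightarrow> real) \<Rightarrow> (real ^ 'n \<Rightarrow> real ^ 'n) \<Rightarrow> bool"
  where "distr_subsolution \<Omega> a lam p f u Du \<longleftrightarrow>
    (\<forall>\<phi>\<in>test_functions \<Omega>. (\<forall>x. \<phi> x \<ge> 0) \<longrightarrow>
      (LINT x:\<Omega>|lebesgue. a x (u x) (Du x) \<bullet> grad \<phi> x)
      + lam * (LINT x:\<Omega>|lebesgue. u x * \<phi> x)
      + (LINT x:\<Omega>|lebesgue. norm (Du x) powr p * \<phi> x)
      \<le> (LINT x:\<Omega>|lebesgue. f x * \<phi> x))"

definition pos_part :: "('a \<Rightarrow> real) \<Rightarrow> 'a \<Rightarrow> real"
  where "pos_part u x = max (u x) 0"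

end

theory Submission
  imports Defs "HOL-Computational_Algebra.Polynomial"
begin

text \<open>
  No Sobolev embedding and no iteration is used. Let \<open>\<phi>\<close> be a smooth bump supported in the ball of
  radius \<open>s\<close> around \<open>x\<close>, chosen so flat that \<open>|\<nabla>\<phi>| \<le> (8/s) \<phi>\<^sup>1\<^sup>/\<^sup>p\<close>, and let \<open>m(s)\<close> be the
  integral of \<open>s\<^sup>-\<^sup>N u \<phi>\<close>. As long as \<open>m(s) \<ge> 0\<close>, the zero-order term has a good sign when the inequality
  is tested with \<open>\<phi>\<close>, and Young's inequality bounds the integral of \<open>|Du|\<^sup>p \<phi>\<close> by a constant times
  \<open>s\<close> to the power \<open>N - \<kappa> p\<close>, where \<open>\<kappa> = max (N/q) 2 / p < 1\<close>. Since \<open>m'(s)\<close> is the integral of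
  \<open>s\<^sup>-\<^sup>N\<^sup>-\<^sup>1 \<phi> (y - x) \<bullet> Du\<close>, this Morrey-type bound gives \<open>|m'(s)| \<le> c s\<^sup>-\<^sup>\<kappa>\<close> wherever
  \<open>m(s) > 0\<close>. That is integrable at \<open>s = 0\<close>, so all small-scale averages of \<open>u\<close> are bounded by the
  average of \<open>u\<^sup>+\<close> at a fixed scale plus a constant, and therefore so is \<open>u\<close> almost everywhere.
\<close>

section \<open>Smooth functions and flat exponentials\<close>

text \<open>Only smooth nonnegative test functions are available, and \<open>u\<close> has no lower
  bound. Requiring a sign of the average m(s) instead of \<open>u\<close> itself lets the plain
  kernel serve as test function, so no truncation of \<open>u\<close> and no Sobolev test function
  is needed. Nothing is claimed where m(s) is negative, hence the bound is one-sided.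

  The flux term contains |Du| |grad \<phi>|. To absorb it into |Du|^p \<phi>, the gradient of \<phi>
  must be controlled by \<phi>^(1/p) right up to the edge of the support; a kernel vanishing
  linearly there would fail.

  The normalisation s^(-N) is chosen because the s-derivative of the scaled kernel is then a
  divergence, so that m'(s) involves \<open>Du\<close> alone. Relative to the volume s^N, the cutoff
  costs s^(-2) and the datum \<open>f\<close> costs s^(-N/q). The hypotheses p > 2 and q > N/p say
  that both exponents stay below p, which makes the bound on m' integrable at 0.\<close>

lemma partial_deriv_eq:
  "(f has_derivative D) (at x) \<Longrightarrow> partial_deriv i f x = D (axis i 1)"
  unfolding partial_deriv_def by (metis frechet_derivative_at)

lemma Ck_Suc_imp_Ck: "Ck (Suc k) f \<Longrightarrow> Ck k f"
proof (induction k arbitrary: f)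
  case 0
  then show ?case
    by (auto intro!: differentiable_imp_continuous_on simp: differentiable_on_def
        intro: differentiable_at_withinI)
next
  case (Suc k)
  have "Ck (Suc k) (partial_deriv i f)" for i
    using Suc.prems by simp
  then have "Ck k (partial_deriv i f)" for i
    using Suc.IH by blast
  moreover have "\<forall>x. f differentiable (at x)"
    using Suc.prems by simp
  ultimately show ?case
    by simp
qed

lemma Ck_const: "Ck k (\<lambda>x :: real ^ 'n::finite. c)"
proof (induction k arbitrary: c)
  case (Suc k)
  have "partial_deriv i (\<lambda>x :: real ^ 'n. c) = (\<lambda>x. 0)" for i
    by (rule ext, subst partial_deriv_eq[of _ "\<lambda>h. 0"]) auto
  then show ?case
    using Suc by simp
qed auto

lemma Ck_add: "Ck k f \<Longrightarrow> Ck k g \<Longrightarrow> Ck k (\<lambda>x. f x + g x)"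
proof (induction k arbitrary: f g)
  case (Suc k)
  have d: "f differentiable (at x)" "g differentiable (at x)" for x
    using Suc.prems by auto
  have "partial_deriv i (\<lambda>x. f x + g x) = (\<lambda>x. partial_deriv i f x + partial_deriv i g x)" for i
  proof
    fix x
    show "partial_deriv i (\<lambda>x. f x + g x) x = partial_deriv i f x + partial_deriv i g x"
      using partial_deriv_eq[OF has_derivative_add[OF
            frechet_derivative_works[THEN iffD1, OF d(1)] frechet_derivative_works[THEN iffD1, OF d(2)]]]
      by (simp add: partial_deriv_def)
  qed
  moreover have "\<forall>x. (\<lambda>x. f x + g x) differentiable (at x)"
    using d by simp
  moreover have "Ck k (\<lambda>x. partial_deriv i f x + partial_deriv i g x)" for i
    using Suc.prems by (intro Suc.IH) auto
  ultimately show ?case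
    by simp
qed (auto intro: continuous_intros)

lemma partial_deriv_mult:
  assumes "f differentiable (at x)" "g differentiable (at x)"
  shows "partial_deriv i (\<lambda>x. f x * g x) x = f x * partial_deriv i g x + partial_deriv i f x * g x"
  using partial_deriv_eq[OF has_derivative_mult[OF
        frechet_derivative_works[THEN iffD1, OF assms(1)] frechet_derivative_works[THEN iffD1, OF assms(2)]]]
  by (simp add: partial_deriv_def)

lemma Ck_mult: "Ck k f \<Longrightarrow> Ck k g \<Longrightarrow> Ck k (\<lambda>x. f x * g x)"
proof (induction k arbitrary: f g)
  case (Suc k)
  have d: "f differentiable (at x)" "g differentiable (at x)" for x
    using Suc.prems by auto
  have "partial_deriv i (\<lambda>x. f x * g x) = (\<lambda>x. f x * partial_deriv i g x + partial_deriv i f x * g x)" for i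
    using d by (intro ext partial_deriv_mult)
  moreover have "\<forall>x. (\<lambda>x. f x * g x) differentiable (at x)"
    using d by simp
  moreover have "Ck k (\<lambda>x. f x * partial_deriv i g x + partial_deriv i f x * g x)" for i
    using Suc.prems Ck_Suc_imp_Ck[OF Suc.prems(1)] Ck_Suc_imp_Ck[OF Suc.prems(2)]
    by (intro Ck_add Suc.IH) auto
  ultimately show ?case
    by simp
qed (auto intro: continuous_intros)

lemma Ck_nth_diff: "Ck k (\<lambda>x :: real ^ 'n::finite. x $ i - c)"
proof (cases k)
  case (Suc m)
  have D: "((\<lambda>x :: real ^ 'n. x $ i - c) has_derivative (\<lambda>h. h $ i)) (at x)" for x
    by (auto intro!: derivative_eq_intros bounded_linear_imp_has_derivative bounded_linear_vec_nth)
  have "partial_deriv j (\<lambda>x :: real ^ 'n. x $ i - c) = (\<lambda>x. axis j 1 $ i)" for j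
    using partial_deriv_eq[OF D] by auto
  moreover have "(\<lambda>x :: real ^ 'n. x $ i - c) differentiable (at x)" for x
    using D differentiable_def by blast
  ultimately show ?thesis
    using Suc by (simp add: Ck_const)
qed (auto intro!: continuous_intros)

lemma Ck_sum:
  assumes "\<And>i. i \<in> I \<Longrightarrow> Ck k (f i)"
  shows "Ck k (\<lambda>x :: real ^ 'n::finite. \<Sum>i\<in>I. f i x)"
  using assms by (induction I rule: infinite_finite_induct) (auto intro: Ck_const Ck_add)

text \<open>The polynomial parameter closes the family under differentiation: every derivative of
  exp(-1/t) is a polynomial in 1/t times exp(-1/t). Smoothness of all orders then follows from one
  first-order statement.\<close>

definition flat_exp :: "real poly \<Rightarrow> real \<Rightarrow> real"
  where "flat_exp P t = (if t > 0 then poly P (1 / t) * exp (- (1 / t)) else 0)"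

text \<open>With y = 1/t, the chain rule turns d/dt into -y^2 d/dy, and the exponential exp(-y)
  contributes the summand \<open>P\<close>.\<close>

definition flat_exp_deriv :: "real poly \<Rightarrow> real poly"
  where "flat_exp_deriv P = monom 1 2 * (P - pderiv P)"

lemma tendsto_poly_mult_exp: "((\<lambda>y. poly P y * exp (- y)) \<longlongrightarrow> (0::real)) at_top"
proof -
  have "((\<lambda>y. \<Sum>i\<le>degree P. coeff P i * (y ^ i / exp y)) \<longlongrightarrow> (\<Sum>i\<le>degree P. coeff P i * 0)) at_top"
    by (intro tendsto_intros tendsto_power_div_exp_0)
  then show ?thesis
    by (simp add: poly_altdef sum_distrib_right sum_divide_distrib exp_minus field_simps)
qed

lemma flat_exp_tendsto_0: "(flat_exp P \<longlongrightarrow> 0) (at 0)"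
proof -
  have "((\<lambda>t. poly P (inverse t) * exp (- inverse t)) \<longlongrightarrow> 0) (at_right (0::real))"
    using filterlim_compose[OF tendsto_poly_mult_exp filterlim_inverse_at_top_right] by simp
  then have "(flat_exp P \<longlongrightarrow> 0) (at_right 0)"
    by (rule Lim_transform_eventually)
       (auto simp: flat_exp_def eventually_at_filter inverse_eq_divide)
  moreover have "(flat_exp P \<longlongrightarrow> 0) (at_left 0)"
    by (rule tendsto_eventually) (auto simp: flat_exp_def eventually_at_filter)
  ultimately show ?thesis
    by (simp add: filterlim_split_at)
qed

lemma flat_exp_has_derivative:
  "(flat_exp P has_real_derivative flat_exp (flat_exp_deriv P) t) (at t)"
proof -
  consider "t > 0" | "t < 0" | "t = 0"
    by linarith
  then show ?thesis
  proof cases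
    case 1
    have "((\<lambda>t. poly P (1 / t) * exp (- (1 / t))) has_real_derivative
        flat_exp (flat_exp_deriv P) t) (at t)"
      using 1
      by (auto intro!: derivative_eq_intros DERIV_chain2[OF poly_DERIV]
          simp: flat_exp_def flat_exp_deriv_def poly_monom field_simps power2_eq_square)
    moreover have "\<forall>\<^sub>F x in nhds t. poly P (1 / x) * exp (- (1 / x)) = flat_exp P x"
      using 1 eventually_nhds_in_open[of "{0::real<..}" t]
      by (auto elim!: eventually_mono simp: flat_exp_def)
    ultimately show ?thesis
      by (subst (asm) DERIV_cong_ev[OF refl _ refl]) auto
  next
    case 2
    have "((\<lambda>t. 0) has_real_derivative flat_exp (flat_exp_deriv P) t) (at t)"
      using 2 by (auto simp: flat_exp_def)
    moreover have "\<forall>\<^sub>F x in nhds t. 0 = flat_exp P x"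
      using 2 eventually_nhds_in_open[of "{..<0}" t]
      by (auto elim!: eventually_mono simp: flat_exp_def)
    ultimately show ?thesis
      by (subst (asm) DERIV_cong_ev[OF refl _ refl]) auto
  next
    case 3
    \<comment> \<open>At the origin the difference quotient is again a flat exponential, with
      polynomial X P, so differentiability reduces to the limit
      \<open>flat_exp_tendsto_0\<close>.\<close>
    have "(flat_exp P h - flat_exp P 0) / h = flat_exp (monom 1 1 * P) h" for h
      by (auto simp: flat_exp_def poly_monom)
    then show ?thesis
      using flat_exp_tendsto_0[of "monom 1 1 * P"] 3
      unfolding DERIV_def by (simp add: flat_exp_def [of _ 0])
  qed
qed

lemma continuous_flat_exp: "continuous_on UNIV (flat_exp P)"
  by (meson DERIV_isCont continuous_at_imp_continuous_on flat_exp_has_derivative)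

text \<open>The induction must be over all \<open>P\<close> at once, because one differentiation
  replaces \<open>P\<close> by \<open>flat_exp_deriv P\<close> and multiplies by a partial
  derivative of the smooth \<open>g\<close>.\<close>

lemma Ck_flat_exp_compose:
  fixes g :: "real ^ 'n::finite \<Rightarrow> real"
  assumes "\<And>k. Ck k g"
  shows "Ck k (\<lambda>x. flat_exp P (g x))"
proof (induction k arbitrary: P)
  case 0
  then show ?case
    using assms[of 0] by (auto intro: continuous_on_compose2[OF continuous_flat_exp])
next
  case (Suc k)
  have d: "g differentiable (at x)" for x
    using assms[of 1] by simp
  have D: "((\<lambda>x. flat_exp P (g x)) has_derivative
      (\<lambda>h. flat_exp (flat_exp_deriv P) (g x) * frechet_derivative g (at x) h)) (at x)" for x
    using has_derivative_compose[OF frechet_derivative_works[THEN iffD1, OF d]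
        flat_exp_has_derivative[unfolded has_field_derivative_def]] by simp
  have "partial_deriv i (\<lambda>x. flat_exp P (g x)) =
      (\<lambda>x. flat_exp (flat_exp_deriv P) (g x) * partial_deriv i g x)" for i
    using partial_deriv_eq[OF D] by (auto simp: partial_deriv_def)
  moreover have "Ck k (partial_deriv i g)" for i
    using assms[of "Suc k"] by simp
  moreover have "(\<lambda>x. flat_exp P (g x)) differentiable (at x)" for x
    using D differentiable_def by blast
  ultimately show ?case
    using Suc by (simp add: Ck_mult)
qed

section \<open>The cutoff kernel\<close>

text \<open>The standard bump exp(-1/(1 - r^2)) at r = |y - x|/s. Using the squared norm keeps the
  inner function polynomial in the coordinates, hence smooth at the centre as well.\<close>

definition cutoff :: "real ^ 'n::finite \<Rightarrow> real \<Rightarrow> real ^ 'n \<Rightarrow> real"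
  where "cutoff x s y = flat_exp 1 (1 - (y - x) \<bullet> (y - x) / s\<^sup>2)"

text \<open>This is the derivative of the profile exp(-1/t), taken at the same argument as in
  \<open>cutoff\<close>; it is not a derivative of the kernel in \<open>y\<close> or in
  \<open>s\<close>. Both of those are multiples of it.\<close>

definition cutoff' :: "real ^ 'n::finite \<Rightarrow> real \<Rightarrow> real ^ 'n \<Rightarrow> real"
  where "cutoff' x s y = flat_exp (monom 1 2) (1 - (y - x) \<bullet> (y - x) / s\<^sup>2)"

lemma flat_exp_deriv_1: "flat_exp_deriv 1 = monom 1 2"
  by (simp add: flat_exp_deriv_def)

lemma cutoff_has_derivative:
  "(cutoff x s has_derivative (\<lambda>h. - (2 / s\<^sup>2) * cutoff' x s y * ((y - x) \<bullet> h))) (at y)"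
proof -
  have "((\<lambda>y. 1 - inverse (s\<^sup>2) * ((y - x) \<bullet> (y - x))) has_derivative
      (\<lambda>h. - (2 / s\<^sup>2) * ((y - x) \<bullet> h))) (at y)"
    by (auto intro!: derivative_eq_intros simp: inner_commute divide_inverse algebra_simps fun_eq_iff)
  then have "((\<lambda>y. 1 - (y - x) \<bullet> (y - x) / s\<^sup>2) has_derivative
      (\<lambda>h. - (2 / s\<^sup>2) * ((y - x) \<bullet> h))) (at y)"
    by (simp add: divide_inverse mult.commute)
  from has_derivative_compose[OF this flat_exp_has_derivative[of 1, unfolded has_field_derivative_def]]
  show ?thesis
    by (simp add: cutoff_def [abs_def] cutoff'_def flat_exp_deriv_1 mult_ac)
qed

lemma partial_deriv_cutoff:
  "partial_deriv i (cutoff x s) y = - (2 / s\<^sup>2) * cutoff' x s y * (y $ i - x $ i)"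
  using partial_deriv_eq[OF cutoff_has_derivative] by (simp add: inner_axis)

lemma cutoff_nonneg: "cutoff x s y \<ge> 0"
  by (simp add: cutoff_def flat_exp_def)

lemma cutoff_le_1: "cutoff x s y \<le> 1"
  by (simp add: cutoff_def flat_exp_def)

lemma one_minus_scaled_norm_pos_iff:
  assumes "s > 0"
  shows "1 - (y - x) \<bullet> (y - x) / s\<^sup>2 > 0 \<longleftrightarrow> norm (y - x) < s"
proof -
  have "1 - (y - x) \<bullet> (y - x) / s\<^sup>2 > 0 \<longleftrightarrow> (norm (y - x))\<^sup>2 < s\<^sup>2"
    using assms by (simp add: power2_norm_eq_inner)
  also have "\<dots> \<longleftrightarrow> norm (y - x) < s"
    using assms by (meson less_eq_real_def norm_ge_zero power_mono_iff power_strict_mono not_le pos2)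
  finally show ?thesis .
qed

lemma cutoff_eq_0:
  assumes "s > 0" "norm (y - x) \<ge> s"
  shows "cutoff x s y = 0" "cutoff' x s y = 0"
  using one_minus_scaled_norm_pos_iff[OF assms(1), of y x] assms(2) by (auto simp: cutoff_def cutoff'_def flat_exp_def)

lemma cutoff_ge:
  assumes "s > 0" "norm (y - x) \<le> s / 2"
  shows "exp (- 2) \<le> cutoff x s y"
proof -
  define t where "t = 1 - (y - x) \<bullet> (y - x) / s\<^sup>2"
  have "(norm (y - x))\<^sup>2 \<le> (s / 2)\<^sup>2"
    using assms by (intro power_mono) auto
  then have "(norm (y - x))\<^sup>2 / s\<^sup>2 \<le> 1 / 4"
    using assms by (simp add: field_simps power2_eq_square)
  then have "t \<ge> 1 / 2"
    unfolding t_def power2_norm_eq_inner by linarith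
  then have "1 / t \<le> 2"
    by (simp add: field_simps)
  then show ?thesis
    using \<open>t \<ge> 1 / 2\<close> by (simp add: cutoff_def flat_exp_def t_def[symmetric])
qed

lemma power2_le_exp:
  fixes w :: real
  assumes "w \<ge> 0"
  shows "w\<^sup>2 \<le> exp w"
proof -
  have "w \<le> (1 + w / 4)\<^sup>2"
    using zero_le_power2[of "1 - w / 4"] by (simp add: power2_eq_square algebra_simps)
  also have "\<dots> \<le> (exp (w / 4))\<^sup>2"
    using assms by (intro power_mono) auto
  also have "\<dots> = exp (w / 2)"
    by (simp flip: exp_double)
  finally have "w\<^sup>2 \<le> (exp (w / 2))\<^sup>2"
    using assms by (intro power_mono) auto
  then show ?thesis
    by (simp flip: exp_double)
qed

lemma cutoff'_nonneg: "cutoff' x s y \<ge> 0"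
  by (simp add: cutoff'_def flat_exp_def poly_monom)

text \<open>With v = 1/t the left side is v^2 exp(-v). Half of the exponential decay absorbs v^2, at
  the cost of the factor 4, and the remaining exp(-v/2) is at most exp(-v/p) because p is at least
  2.\<close>

lemma cutoff'_le:
  assumes "p \<ge> 2"
  shows "cutoff' x s y \<le> 4 * cutoff x s y powr (1 / p)"
proof -
  define t where "t = 1 - (y - x) \<bullet> (y - x) / s\<^sup>2"
  show ?thesis
  proof (cases "t > 0")
    case True
    define v where "v = 1 / t"
    have v: "v > 0"
      using True by (simp add: v_def)
    have "v\<^sup>2 = 4 * (v / 2)\<^sup>2"
      by (simp add: power2_eq_square)
    also have "\<dots> \<le> 4 * exp (v / 2)"
      using power2_le_exp[of "v / 2"] v by simp
    finally have "v\<^sup>2 * exp (- v) \<le> 4 * exp (v / 2) * exp (- v)"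
      by (rule mult_right_mono) simp
    also have "\<dots> = 4 * exp (- (v / 2))"
      by (simp flip: exp_add add: field_simps)
    also have "\<dots> \<le> 4 * exp (- (v / p))"
      using v assms divide_left_mono[of 2 p v] by simp
    also have "\<dots> = 4 * exp (- v) powr (1 / p)"
      by (simp add: powr_def)
    finally show ?thesis
      using True by (simp add: cutoff_def cutoff'_def flat_exp_def poly_monom
          t_def[symmetric] v_def power_one_over)
  next
    case False
    then show ?thesis
      by (simp add: cutoff_def cutoff'_def flat_exp_def t_def)
  qed
qed

lemma cutoff'_le_4: "cutoff' x s y \<le> 4"
proof -
  have "cutoff x s y powr (1 / 2) \<le> 1"
    using cutoff_nonneg[of x s y] cutoff_le_1[of x s y] by (intro powr_le1) auto
  then show ?thesis
    using cutoff'_le[of 2 x s y] by linarith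
qed

lemma grad_cutoff: "grad (cutoff x s) y = (- (2 / s\<^sup>2) * cutoff' x s y) *\<^sub>R (y - x)"
  by (simp add: grad_def vec_eq_iff partial_deriv_cutoff)

text \<open>The power 1/p is what makes |Du| times this gradient a multiple of the p-th root of
  |Du|^p \<phi>. The 8 is 2 from differentiating the square times 4 from \<open>cutoff'_le\<close>,
  and |y - x| < s on the support removes one of the two powers of 1/s.\<close>

lemma norm_grad_cutoff_le:
  assumes "s > 0" "p \<ge> 2"
  shows "norm (grad (cutoff x s) y) \<le> 8 / s * cutoff x s y powr (1 / p)"
proof (cases "norm (y - x) < s")
  case True
  have "norm (grad (cutoff x s) y) = 2 / s\<^sup>2 * cutoff' x s y * norm (y - x)"
    by (simp add: grad_cutoff abs_mult cutoff'_nonneg)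
  also have "\<dots> \<le> 2 / s\<^sup>2 * (4 * cutoff x s y powr (1 / p)) * s"
    using True assms cutoff'_nonneg by (intro mult_mono cutoff'_le) auto
  also have "\<dots> = 8 / s * cutoff x s y powr (1 / p)"
    using assms by (simp add: power2_eq_square)
  finally show ?thesis .
next
  case False
  then show ?thesis
    using assms cutoff_eq_0[of s y x] by (simp add: grad_cutoff)
qed

lemma Ck_cutoff: "Ck k (cutoff x s)"
proof -
  have "(\<lambda>y. 1 - (y - x) \<bullet> (y - x) / s\<^sup>2) =
      (\<lambda>y. 1 + (- 1 / s\<^sup>2) * (\<Sum>i\<in>UNIV. (y $ i - x $ i) * (y $ i - x $ i)))"
    by (auto simp: inner_vec_def)
  moreover have "Ck k (\<lambda>y. 1 + (- 1 / s\<^sup>2) * (\<Sum>i\<in>UNIV. (y $ i - x $ i) * (y $ i - x $ i)))" for k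
    by (intro Ck_add Ck_const Ck_mult Ck_sum Ck_nth_diff)
  ultimately have "Ck k (\<lambda>y. 1 - (y - x) \<bullet> (y - x) / s\<^sup>2)" for k
    by simp
  then have "Ck k (\<lambda>y. flat_exp 1 (1 - (y - x) \<bullet> (y - x) / s\<^sup>2))"
    by (rule Ck_flat_exp_compose)
  then show ?thesis
    by (simp add: cutoff_def [abs_def])
qed

lemma test_functions_cballI:
  assumes "\<And>k. Ck k \<phi>" "\<And>y. y \<notin> cball x s \<Longrightarrow> \<phi> y = 0" "cball x s \<subseteq> \<Omega>"
  shows "\<phi> \<in> test_functions \<Omega>"
proof -
  have "closure {y. \<phi> y \<noteq> 0} \<subseteq> cball x s"
    using assms(2) by (intro closure_minimal closed_cball) blast
  then show ?thesis
    using assms by (auto simp: test_functions_def compact_eq_bounded_closed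
        intro: bounded_subset[OF bounded_cball])
qed

lemma cutoff_test_function:
  assumes "s > 0" "cball x s \<subseteq> \<Omega>"
  shows "cutoff x s \<in> test_functions \<Omega>"
    and "(\<lambda>y. (y $ i - x $ i) * cutoff x s y) \<in> test_functions \<Omega>"
proof -
  have "cutoff x s y = 0" if "y \<notin> cball x s" for y
    using that cutoff_eq_0[OF assms(1), of y x] by (simp add: dist_norm norm_minus_commute)
  then show "cutoff x s \<in> test_functions \<Omega>"
      "(\<lambda>y. (y $ i - x $ i) * cutoff x s y) \<in> test_functions \<Omega>"
    using assms by (auto intro!: test_functions_cballI[where x = x and s = s] Ck_cutoff Ck_mult Ck_nth_diff)
qed

lemma continuous_cutoff: "continuous_on UNIV (cutoff x s)"
  using Ck_cutoff[of 0 x s] by simp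

lemma continuous_cutoff': "continuous_on UNIV (cutoff' x s)"
  unfolding cutoff'_def [abs_def] divide_inverse
  by (intro continuous_on_compose2[OF continuous_flat_exp] continuous_intros) auto

text \<open>The divergence in \<open>y\<close> of the field (y - x) \<phi>(y), expanded so that its
  continuity and its size can be read off.\<close>

definition radial_div :: "real ^ 'n::finite \<Rightarrow> real \<Rightarrow> real ^ 'n \<Rightarrow> real"
  where "radial_div x s y = real CARD('n) * cutoff x s y
    - 2 / s\<^sup>2 * cutoff' x s y * ((y - x) \<bullet> (y - x))"

lemma radial_div_eq:
  "radial_div x s y = (\<Sum>i\<in>UNIV. partial_deriv i (\<lambda>y. (y $ i - x $ i) * cutoff x s y) y)"
proof -
  have d: "cutoff x s differentiable (at y)"
    using cutoff_has_derivative differentiable_def by blast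
  have D: "((\<lambda>y. y $ i - x $ i) has_derivative (\<lambda>h. h $ i)) (at y)" for i
    by (auto intro!: derivative_eq_intros bounded_linear_imp_has_derivative bounded_linear_vec_nth)
  have "partial_deriv i (\<lambda>y. (y $ i - x $ i) * cutoff x s y) y =
      (y $ i - x $ i) * (- (2 / s\<^sup>2) * cutoff' x s y * (y $ i - x $ i)) + cutoff x s y" for i
    by (subst partial_deriv_mult)
      (auto simp: d partial_deriv_cutoff partial_deriv_eq[OF D] intro: differentiableI[OF D])
  then show ?thesis
    by (simp add: radial_div_def sum_subtractf inner_vec_def sum_distrib_left mult_ac)
qed

lemma continuous_radial_div: "continuous_on UNIV (radial_div x s)"
  unfolding radial_div_def [abs_def]
  by (intro continuous_intros continuous_cutoff continuous_cutoff')

lemma radial_div_eq_0: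
  assumes "s > 0" "norm (y - x) \<ge> s"
  shows "radial_div x s y = 0"
  using cutoff_eq_0[OF assms] by (simp add: radial_div_def)

text \<open>On the support |y - x|^2 is at most s^2, which cancels the factor 1/s^2. The bound is
  therefore uniform in the scale, and it supplies the domination when the averages are
  differentiated in \<open>s\<close>.\<close>

lemma abs_radial_div_le:
  assumes "s > 0"
  shows "\<bar>radial_div (x :: real ^ 'n::finite) s y\<bar> \<le> real CARD('n) + 8"
proof (cases "norm (y - x) < s")
  case True
  have "(norm (y - x))\<^sup>2 \<le> s\<^sup>2"
    using True by (intro power_mono) auto
  then have "(y - x) \<bullet> (y - x) \<le> s\<^sup>2"
    by (simp add: power2_norm_eq_inner)
  then have "2 / s\<^sup>2 * cutoff' x s y * ((y - x) \<bullet> (y - x)) \<le> 2 / s\<^sup>2 * 4 * s\<^sup>2"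
    using cutoff'_nonneg by (intro mult_mono cutoff'_le_4) auto
  also have "\<dots> = 8"
    using assms by simp
  finally have "2 / s\<^sup>2 * cutoff' x s y * ((y - x) \<bullet> (y - x)) \<le> 8" .
  moreover have "0 \<le> 2 / s\<^sup>2 * cutoff' x s y * ((y - x) \<bullet> (y - x))"
    using cutoff'_nonneg by (intro mult_nonneg_nonneg) auto
  moreover have "0 \<le> real CARD('n) * cutoff x s y" "real CARD('n) * cutoff x s y \<le> real CARD('n)"
    using cutoff_nonneg[of x s y] cutoff_le_1[of x s y] by (auto intro: mult_left_le)
  ultimately show ?thesis
    unfolding radial_div_def by linarith
next
  case False
  then show ?thesis
    using radial_div_eq_0[OF assms, of y x] by simp
qed

text \<open>Dilating the kernel amounts to taking the divergence of a compactly supported radial field.\<close>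

lemma scaled_cutoff_has_derivative:
  fixes x y :: "real ^ 'n::finite"
  assumes "s > 0"
  shows "((\<lambda>s. s powr - real CARD('n) * cutoff x s y) has_real_derivative
    - (s powr (- real CARD('n) - 1) * radial_div x s y)) (at s)"
proof -
  have "((\<lambda>s. 1 - (y - x) \<bullet> (y - x) / s\<^sup>2) has_real_derivative 2 * ((y - x) \<bullet> (y - x)) / s ^ 3) (at s)"
    using assms by (auto intro!: derivative_eq_intros simp: field_simps power2_eq_square power3_eq_cube)
  from DERIV_chain2[OF flat_exp_has_derivative[of 1] this]
  have 1: "((\<lambda>s. cutoff x s y) has_real_derivative
      cutoff' x s y * (2 * ((y - x) \<bullet> (y - x)) / s ^ 3)) (at s)"
    by (simp add: cutoff_def cutoff'_def flat_exp_deriv_1)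
  have e: "s powr - real CARD('n) = s powr (- real CARD('n) - 1) * s"
    using assms by (simp add: powr_diff)
  have 2: "((\<lambda>s. s powr - real CARD('n)) has_real_derivative
      (- real CARD('n)) * s powr (- real CARD('n) - 1)) (at s)"
    using assms by (auto intro!: derivative_eq_intros)
  show ?thesis
    by (rule DERIV_cong[OF DERIV_mult[OF 2 1]], subst e)
      (use assms in \<open>simp add: radial_div_def field_simps power2_eq_square power3_eq_cube\<close>)
qed

section \<open>Differentiating weighted integrals and a comparison lemma\<close>

text \<open>Differentiation under the integral sign. By the mean value inequality the difference
  quotients of the kernel are at most \<open>C\<close>, so C |w| dominates along every sequence
  tending to \<open>s\<close>; no regularity of the weight beyond integrability enters.\<close>

lemma has_real_derivative_weighted_integral:
  fixes w :: "'a \<Rightarrow> real" and k k' :: "real \<Rightarrow> 'a \<Rightarrow> real"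
  assumes w: "integrable M w" and s: "s \<in> {a<..<b}"
    and deriv: "\<And>t y. t \<in> {a<..<b} \<Longrightarrow> ((\<lambda>t. k t y) has_real_derivative k' t y) (at t)"
    and bound: "\<And>t y. t \<in> {a<..<b} \<Longrightarrow> \<bar>k' t y\<bar> \<le> C"
    and int: "\<And>t. t \<in> {a<..<b} \<Longrightarrow> integrable M (\<lambda>y. w y * k t y)"
    and meas: "k' s \<in> borel_measurable M"
  shows "((\<lambda>t. \<integral>y. w y * k t y \<partial>M) has_real_derivative (\<integral>y. w y * k' s y \<partial>M)) (at s)"
proof -
  let ?I = "\<lambda>t. \<integral>y. w y * k t y \<partial>M"
  have "((\<lambda>t. (?I t - ?I s) / (t - s)) \<longlongrightarrow> (\<integral>y. w y * k' s y \<partial>M)) (at s within {a<..<b})"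
    unfolding tendsto_at_iff_sequentially comp_def
  proof (intro allI impI)
    fix X :: "nat \<Rightarrow> real"
    assume X: "\<forall>i. X i \<in> {a<..<b} - {s}" and lim: "X \<longlonglongrightarrow> s"
    have "(\<lambda>i. \<integral>y. w y * ((k (X i) y - k s y) / (X i - s)) \<partial>M) \<longlonglongrightarrow> (\<integral>y. w y * k' s y \<partial>M)"
    proof (rule integral_dominated_convergence[where w = "\<lambda>y. \<bar>w y\<bar> * C"])
      show "(\<lambda>y. w y * k' s y) \<in> borel_measurable M"
        using w meas by measurable
      show "(\<lambda>y. w y * ((k (X i) y - k s y) / (X i - s))) \<in> borel_measurable M" for i
      proof -
        have "(\<lambda>y. (w y * k (X i) y - w y * k s y) / (X i - s)) \<in> borel_measurable M"
          using X s by (intro borel_measurable_divide borel_measurable_diff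
              borel_measurable_const borel_measurable_integrable int) auto
        then show ?thesis
          by (simp add: algebra_simps)
      qed
      show "integrable M (\<lambda>y. \<bar>w y\<bar> * C)"
        using w by auto
      show "AE y in M. (\<lambda>i. w y * ((k (X i) y - k s y) / (X i - s))) \<longlonglongrightarrow> w y * k' s y"
      proof (rule AE_I2)
        fix y
        have "((\<lambda>t. (k t y - k s y) / (t - s)) \<longlongrightarrow> k' s y) (at s within {a<..<b})"
          using has_field_derivative_at_within[OF deriv[OF s, of y], of "{a<..<b}"]
          by (simp only: has_field_derivative_iff)
        then have "(\<lambda>i. (k (X i) y - k s y) / (X i - s)) \<longlonglongrightarrow> k' s y"
          using X lim unfolding tendsto_at_iff_sequentially comp_def by simp
        then show "(\<lambda>i. w y * ((k (X i) y - k s y) / (X i - s))) \<longlonglongrightarrow> w y * k' s y"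
          by (intro tendsto_intros)
      qed
      show "AE y in M. norm (w y * ((k (X i) y - k s y) / (X i - s))) \<le> \<bar>w y\<bar> * C" for i
      proof (rule AE_I2)
        fix y
        have "norm (k (X i) y - k s y) \<le> C * norm (X i - s)"
          using X s by (intro field_differentiable_bound[of "{a<..<b}" "\<lambda>t. k t y" "\<lambda>t. k' t y"])
            (auto intro: has_field_derivative_at_within[OF deriv] bound)
        moreover have "X i \<noteq> s"
          using X by auto
        ultimately have "\<bar>(k (X i) y - k s y) / (X i - s)\<bar> \<le> C"
          by (simp add: field_simps)
        then show "norm (w y * ((k (X i) y - k s y) / (X i - s))) \<le> \<bar>w y\<bar> * C"
          unfolding real_norm_def abs_mult by (intro mult_left_mono) auto
      qed
    qed
    moreover have "(\<integral>y. w y * ((k (X i) y - k s y) / (X i - s)) \<partial>M) = (?I (X i) - ?I s) / (X i - s)" for i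
    proof -
      have "(?I (X i) - ?I s) / (X i - s) = (\<integral>y. (w y * k (X i) y - w y * k s y) / (X i - s) \<partial>M)"
        using int[of "X i"] int[of s] X s by simp
      then show ?thesis
        by (auto simp: right_diff_distrib)
    qed
    ultimately show "(\<lambda>i. (?I (X i) - ?I s) / (X i - s)) \<longlonglongrightarrow> (\<integral>y. w y * k' s y \<partial>M)"
      by (simp only:)
  qed
  then show ?thesis
    using s by (simp add: has_field_derivative_iff at_within_open[of s "{a<..<b}"])
qed

text \<open>While \<open>m\<close> is positive its derivative is integrable near \<open>0\<close>, so going down from \<open>b\<close>
  it can only rise by a bounded amount after its last zero.\<close>

lemma le_of_derivative_bound_while_positive:
  fixes m m' :: "real \<Rightarrow> real"
  assumes s: "0 < s" "s \<le> b" and \<kappa>: "\<kappa> < 1" and A: "A \<ge> 0"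
    and deriv: "\<And>t. \<lbrakk>0 < t; t \<le> b\<rbrakk> \<Longrightarrow> (m has_real_derivative m' t) (at t)"
    and bound: "\<And>t. \<lbrakk>0 < t; t \<le> b; m t > 0\<rbrakk> \<Longrightarrow> \<bar>m' t\<bar> \<le> A * t powr - \<kappa>"
  shows "m s \<le> max (m b) 0 + A / (1 - \<kappa>) * b powr (1 - \<kappa>)"
proof -
  have cont: "continuous_on {s..b} m"
    using s by (intro continuous_at_imp_continuous_on) (auto intro!: DERIV_isCont deriv)
  \<comment> \<open>The point \<open>t\<close> is the first one at or above \<open>s\<close> where
    \<open>m\<close> is nonpositive, or \<open>b\<close> if there is none. The derivative bound is
    available on all of [s, t), and the value at \<open>t\<close> is controlled in both
    cases.\<close>
  have "\<exists>t. s \<le> t \<and> t \<le> b \<and> m t \<le> max (m b) 0 \<and> (\<forall>r. s \<le> r \<and> r < t \<longrightarrow> m r > 0)"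
  proof (cases "\<exists>t\<in>{s..b}. m t \<le> 0")
    case True
    define T where "T = {s..b} \<inter> m -` {..0}"
    have "closed T"
      unfolding T_def by (intro continuous_closed_preimage cont closed_atLeastAtMost closed_atMost)
    moreover have "T \<noteq> {}" "bdd_below T"
      using True by (auto simp: T_def)
    ultimately have "Inf T \<in> T"
      by (intro closed_contains_Inf)
    moreover have "m r > 0" if "s \<le> r" "r < Inf T" for r
    proof (rule ccontr)
      assume "\<not> m r > 0"
      then have "r \<in> T"
        using that \<open>Inf T \<in> T\<close> by (auto simp: T_def)
      then show False
        using that cInf_lower[OF _ \<open>bdd_below T\<close>] by fastforce
    qed
    ultimately show ?thesis
      by (intro exI[of _ "Inf T"]) (auto simp: T_def)
  next
    case False
    then show ?thesis
      using s by (intro exI[of _ b]) force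
  qed
  then obtain t where t: "s \<le> t" "t \<le> b" "m t \<le> max (m b) 0" "\<And>r. s \<le> r \<Longrightarrow> r < t \<Longrightarrow> m r > 0"
    by blast
  \<comment> \<open>The added term is the primitive of A r^(-\<kappa>) that vanishes at 0, so
    \<open>D\<close> is nondecreasing wherever the derivative bound holds, and \<open>m s\<close> is
    at most \<open>D s\<close>.\<close>
  define D where "D r = m r + A / (1 - \<kappa>) * r powr (1 - \<kappa>)" for r
  have derivD: "(D has_real_derivative m' r + A * r powr - \<kappa>) (at r)" if "0 < r" "r \<le> b" for r
    unfolding D_def using that \<kappa> by (auto intro!: derivative_eq_intros deriv)
  have "D s \<le> D t"
  proof (rule DERIV_nonneg_imp_increasing_open[OF t(1)])
    fix r
    assume r: "s < r" "r < t"
    then have "\<bar>m' r\<bar> \<le> A * r powr - \<kappa>"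
      using s t by (intro bound) auto
    then show "\<exists>y. (D has_real_derivative y) (at r) \<and> 0 \<le> y"
      using derivD[of r] r s t by (intro exI[of _ "m' r + A * r powr - \<kappa>"]) auto
  next
    show "continuous_on {s..t} D"
      using s t by (intro continuous_at_imp_continuous_on) (auto intro!: DERIV_isCont derivD)
  qed
  moreover have "A / (1 - \<kappa>) * t powr (1 - \<kappa>) \<le> A / (1 - \<kappa>) * b powr (1 - \<kappa>)"
    using A \<kappa> s t by (intro mult_left_mono powr_mono2) auto
  moreover have "A / (1 - \<kappa>) * s powr (1 - \<kappa>) \<ge> 0"
    using A \<kappa> by simp
  ultimately show ?thesis
    using t(3) by (simp add: D_def)
qed

section \<open>From averages to pointwise bounds\<close>

lemma integral_lborel_reflect:
  fixes k :: "'a::euclidean_space \<Rightarrow> real"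
  assumes [measurable]: "k \<in> borel_measurable borel"
  shows "(\<integral>x. k (y - x) \<partial>lborel) = (\<integral>x. k x \<partial>lborel)"
proof -
  have "(\<integral>x. k x \<partial>lborel) = (\<integral>x. k x \<partial>density (distr lborel borel (\<lambda>x. y + (- 1) *\<^sub>R x)) (\<lambda>_. 1))"
    using lborel_affine[of "- 1" y] by simp
  also have "\<dots> = (\<integral>x. k (y - x) \<partial>lborel)"
    by (simp add: density_1 integral_distr)
  finally show ?thesis
    by simp
qed

text \<open>By Fubini the averages of \<open>w\<close> against the kernels turn into pairings of \<open>w\<close> with
  mollifications of \<open>G\<close>; this avoids differentiating the integral of \<open>w\<close> at Lebesgue points.\<close>

lemma integral_mult_continuous_nonpos_of_averages:
  fixes w G :: "'a::euclidean_space \<Rightarrow> real" and k :: "nat \<Rightarrow> 'a \<Rightarrow> real"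
  assumes w: "integrable lborel w"
    and k_cont: "\<And>n. continuous_on UNIV (k n)"
    and k_nonneg: "\<And>n z. k n z \<ge> 0"
    and k_supp: "\<And>n z. norm z \<ge> r n \<Longrightarrow> k n z = 0"
    and r: "r \<longlonglongrightarrow> 0"
    and k_pos: "\<And>n. (\<integral>z. k n z \<partial>lborel) > 0"
    and avg: "\<And>n x. x \<in> S \<Longrightarrow> (\<integral>y. w y * k n (y - x) \<partial>lborel) \<le> 0"
    and G: "continuous_on UNIV G" "\<And>x. G x \<ge> 0" "\<And>x. G x \<le> 1" "\<And>x. x \<notin> C \<Longrightarrow> G x = 0"
    and C: "compact C" "C \<subseteq> S"
  shows "(\<integral>y. w y * G y \<partial>lborel) \<le> 0"
proof -
  have [measurable]: "w \<in> borel_measurable borel" "\<And>n. k n \<in> borel_measurable borel"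
      "G \<in> borel_measurable borel" "C \<in> sets borel"
    using w k_cont G(1) C(1)
    by (auto intro: borel_measurable_continuous_onI borel_compact dest: borel_measurable_integrable)
  define J where "J n = (\<integral>z. k n z \<partial>lborel)" for n
  have Jpos: "J n > 0" for n
    using k_pos by (simp add: J_def)
  have k_bdd: "\<exists>B. \<forall>z. k n z \<le> B" for n
  proof -
    have "bounded (k n ` cball 0 (r n))"
      by (intro compact_imp_bounded compact_continuous_image continuous_on_subset[OF k_cont]) auto
    then obtain B where B: "\<forall>z\<in>cball 0 (r n). norm (k n z) \<le> B"
      by (auto simp: bounded_iff)
    have "k n z \<le> max B 0" for z
    proof (cases "norm z \<le> r n")
      case True
      then have "norm (k n z) \<le> B"
        using B by auto
      then show ?thesis
        by auto
    next
      case False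
      then show ?thesis
        using k_supp[of n z] by auto
    qed
    then show ?thesis
      by blast
  qed
  \<comment> \<open>A non-integrable function has integral \<open>0\<close>, so the strict
    positivity in \<open>k_pos\<close> already yields integrability.\<close>
  have k_int: "integrable lborel (k n)" for n
    using k_pos[of n] not_integrable_integral_eq[of lborel "k n"] by fastforce
  have k_int': "integrable lborel (\<lambda>x. k n (y - x))" "(\<integral>x. k n (y - x) \<partial>lborel) = J n" for n y
  proof -
    show e: "(\<integral>x. k n (y - x) \<partial>lborel) = J n"
      unfolding J_def by (rule integral_lborel_reflect) simp
    then show "integrable lborel (\<lambda>x. k n (y - x))"
      using Jpos[of n] not_integrable_integral_eq[of lborel "\<lambda>x. k n (y - x)"] by fastforce
  qed
  \<comment> \<open>The convolution of \<open>G\<close> with the kernel, left unnormalised; the mass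
    \<open>J n\<close> is divided out only when passing to the limit.\<close>
  define g where "g n y = (\<integral>x. G x * k n (y - x) \<partial>lborel)" for n y
  have Gk_int: "integrable lborel (\<lambda>x. G x * k n (y - x))" for n y
    by (rule Bochner_Integration.integrable_bound[OF k_int'(1)[of n y]])
      (use G k_nonneg in \<open>auto simp: abs_mult intro!: mult_left_le_one_le\<close>)
  have g_nonneg: "g n y \<ge> 0" for n y
    unfolding g_def using G k_nonneg by (intro integral_nonneg_AE) auto
  have g_le: "g n y \<le> J n" for n y
    unfolding g_def k_int'(2)[of n y, symmetric]
    by (intro integral_mono Gk_int k_int') (use G k_nonneg in \<open>auto intro!: mult_left_le_one_le\<close>)
  have g_meas[measurable]: "g n \<in> borel_measurable borel" for n
    unfolding g_def [abs_def] by measurable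
  have nonpos: "(\<integral>y. w y * g n y \<partial>lborel) \<le> 0" for n
  proof -
    obtain B where B: "\<And>z. k n z \<le> B"
      using k_bdd by blast
    have B0: "B \<ge> 0"
      using B[of 0] k_nonneg[of n 0] by linarith
    let ?F = "\<lambda>(x, y). G x * (w y * k n (y - x))"
    \<comment> \<open>The majorant for Fubini: \<open>G\<close> is at most the indicator of the
      compact set \<open>C\<close> and the kernel is at most \<open>B\<close>, which leaves a
      product of two integrable functions of one variable.\<close>
    have prod_int: "integrable (lborel \<Otimes>\<^sub>M lborel) (\<lambda>(x, y). indicator C x * (\<bar>w y\<bar> * B))"
    proof (rule lborel_pair.Fubini_integrable)
      show "(\<lambda>(x, y). indicator C x * (\<bar>w y\<bar> * B)) \<in> borel_measurable (lborel \<Otimes>\<^sub>M lborel)"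
        by measurable
      show "integrable lborel (\<lambda>x. \<integral>y. norm (case (x, y) of (x, y) \<Rightarrow> indicator C x * (\<bar>w y\<bar> * B)) \<partial>lborel)"
        using C emeasure_compact_finite[of C] by (auto simp: abs_mult integrable_indicator_iff)
      show "AE x in lborel. integrable lborel (\<lambda>y. case (x, y) of (x, y) \<Rightarrow> indicator C x * (\<bar>w y\<bar> * B))"
        using w by auto
    qed
    have F_int: "integrable (lborel \<Otimes>\<^sub>M lborel) ?F"
    proof (rule Bochner_Integration.integrable_bound[OF prod_int])
      show "AE z in lborel \<Otimes>\<^sub>M lborel. norm (?F z) \<le> norm (case z of (x, y) \<Rightarrow> indicator C x * (\<bar>w y\<bar> * B))"
      proof (rule AE_I2, clarsimp simp del: indicator_simps)
        fix x y
        have "\<bar>G x\<bar> \<le> indicator C x"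
          using G by (auto simp: indicator_def)
        moreover have "\<bar>k n (y - x)\<bar> \<le> \<bar>B\<bar>"
          using B[of "y - x"] k_nonneg[of n "y - x"] by auto
        ultimately show "\<bar>G x * (w y * k n (y - x))\<bar> \<le> \<bar>indicator C x * (\<bar>w y\<bar> * B)\<bar>"
          by (auto simp: abs_mult intro!: mult_mono)
      qed
    qed measurable
    have "(\<integral>y. w y * g n y \<partial>lborel) = (\<integral>y. (\<integral>x. G x * (w y * k n (y - x)) \<partial>lborel) \<partial>lborel)"
      unfolding g_def by (simp flip: integral_mult_right_zero add: mult_ac)
    also have "\<dots> = (\<integral>x. (\<integral>y. G x * (w y * k n (y - x)) \<partial>lborel) \<partial>lborel)"
      using lborel_pair.Fubini_integral[OF F_int] by simp
    also have "\<dots> = (\<integral>x. G x * (\<integral>y. w y * k n (y - x) \<partial>lborel) \<partial>lborel)"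
      by simp
    also have "\<dots> \<le> 0"
    proof -
      have "0 \<le> (\<integral>x. - (G x * (\<integral>y. w y * k n (y - x) \<partial>lborel)) \<partial>lborel)"
      proof (intro integral_nonneg_AE AE_I2)
        fix x
        show "0 \<le> - (G x * (\<integral>y. w y * k n (y - x) \<partial>lborel))"
        proof (cases "x \<in> C")
          case True
          then show ?thesis
            using avg[of x n] C G(2)[of x] by (auto simp: mult_nonneg_nonpos)
        qed (simp add: G)
      qed
      then show ?thesis
        by simp
    qed
    finally show ?thesis .
  qed
  have lim: "(\<lambda>n. g n y / J n) \<longlonglongrightarrow> G y" for y
  proof (rule LIMSEQ_I)
    fix e :: real
    assume e: "0 < e"
    have "isCont G y"
      using G(1) by (simp add: continuous_on_eq_continuous_at)
    then obtain d where d: "d > 0" "\<And>x. dist x y < d \<Longrightarrow> dist (G x) (G y) < e / 2"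
      unfolding continuous_at_eps_delta using e half_gt_zero by blast
    obtain n0 where n0: "\<And>n. n \<ge> n0 \<Longrightarrow> norm (r n - 0) < d"
      using LIMSEQ_D[OF r d(1)] by blast
    have "norm (g n y / J n - G y) < e" if n: "n \<ge> n0" for n
    proof -
      have "g n y - J n * G y = (\<integral>x. (G x - G y) * k n (y - x) \<partial>lborel)"
        unfolding g_def k_int'(2)[of n y, symmetric]
        using Gk_int[of n y] k_int'(1)[of n y] by (simp add: left_diff_distrib mult.commute)
      also have "\<bar>\<dots>\<bar> \<le> (\<integral>x. e / 2 * k n (y - x) \<partial>lborel)"
        unfolding real_norm_def[symmetric]
      proof (rule Bochner_Integration.integral_norm_bound_integral)
        show "integrable lborel (\<lambda>x. (G x - G y) * k n (y - x))"
          using Gk_int[of n y] k_int'(1)[of n y] by (simp add: left_diff_distrib)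
        show "integrable lborel (\<lambda>x. e / 2 * k n (y - x))"
          using k_int'(1)[of n y] by simp
        fix x
        show "norm ((G x - G y) * k n (y - x)) \<le> e / 2 * k n (y - x)"
        proof (cases "norm (y - x) \<ge> r n")
          case True
          then show ?thesis
            using k_supp by simp
        next
          case False
          then have "dist x y < d"
            using n0[OF n] by (auto simp: dist_norm norm_minus_commute)
          then have "\<bar>G x - G y\<bar> \<le> e / 2"
            using d(2)[of x] by (simp add: dist_real_def)
          then show ?thesis
            using k_nonneg[of n "y - x"] mult_right_mono[of "\<bar>G x - G y\<bar>" "e / 2" "k n (y - x)"]
            by (simp add: abs_mult)
        qed
      qed
      also have "\<dots> = e / 2 * J n"
        using k_int'(2) by simp
      finally have "\<bar>g n y - J n * G y\<bar> \<le> e / 2 * J n" .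
      moreover have "g n y / J n - G y = (g n y - J n * G y) / J n"
        using Jpos[of n] by (simp add: field_simps)
      ultimately have "\<bar>g n y / J n - G y\<bar> \<le> e / 2"
        using Jpos[of n] by (simp add: field_simps)
      then show ?thesis
        using e by simp
    qed
    then show "\<exists>n0. \<forall>n\<ge>n0. norm (g n y / J n - G y) < e"
      by blast
  qed
  have "(\<lambda>n. \<integral>y. w y * (g n y / J n) \<partial>lborel) \<longlonglongrightarrow> (\<integral>y. w y * G y \<partial>lborel)"
  proof (rule integral_dominated_convergence[where w = "\<lambda>y. \<bar>w y\<bar>"])
    show "AE y in lborel. (\<lambda>n. w y * (g n y / J n)) \<longlonglongrightarrow> w y * G y"
      by (intro AE_I2 tendsto_intros lim)
    show "AE y in lborel. norm (w y * (g n y / J n)) \<le> \<bar>w y\<bar>" for n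
    proof (rule AE_I2)
      fix y
      have "g n y / J n \<le> 1" "g n y / J n \<ge> 0"
        using g_le[of n y] g_nonneg[of n y] Jpos[of n] by auto
      then show "norm (w y * (g n y / J n)) \<le> \<bar>w y\<bar>"
        unfolding real_norm_def abs_mult by (intro mult_left_le) auto
    qed
  qed (use w in auto)
  moreover have "(\<integral>y. w y * (g n y / J n) \<partial>lborel) \<le> 0" for n
    using nonpos[of n] Jpos[of n] by (simp add: divide_nonpos_pos)
  ultimately show ?thesis
    by (intro LIMSEQ_le_const2) auto
qed

text \<open>Continuous cutoffs \<open>G m\<close>, equal to 1 on a compact set and shrinking towards
  it, extend the previous sign to integrals of \<open>w\<close> over compact subsets of
  \<open>S\<close>. Inner regularity then excludes a set of positive measure on which
  \<open>w\<close> is positive.\<close>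

lemma AE_nonpos_of_averages_lborel:
  fixes w :: "'a::euclidean_space \<Rightarrow> real" and k :: "nat \<Rightarrow> 'a \<Rightarrow> real"
  assumes w: "integrable lborel w" and S: "open S"
    and k_cont: "\<And>n. continuous_on UNIV (k n)"
    and k_nonneg: "\<And>n z. k n z \<ge> 0"
    and k_supp: "\<And>n z. norm z \<ge> r n \<Longrightarrow> k n z = 0"
    and r: "r \<longlonglongrightarrow> 0"
    and k_pos: "\<And>n. (\<integral>z. k n z \<partial>lborel) > 0"
    and avg: "\<And>n x. x \<in> S \<Longrightarrow> (\<integral>y. w y * k n (y - x) \<partial>lborel) \<le> 0"
  shows "AE x in lborel. x \<in> S \<longrightarrow> w x \<le> 0"
proof -
  have [measurable]: "w \<in> borel_measurable borel"
    using w by auto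
  have compact_nonpos: "(\<integral>y. w y * indicator K y \<partial>lborel) \<le> 0" if K: "compact K" "K \<subseteq> S" for K
  proof (cases "K = {}")
    case False
    obtain e where e: "e > 0" "{x. infdist x K \<le> e} \<subseteq> S"
      using compact_in_open_separated[OF False K(1) S K(2)] by blast
    define G where "G m x = max 0 (1 - real (Suc m) / e * infdist x K)" for m x
    have Gc: "continuous_on UNIV (G m)" for m
      unfolding G_def [abs_def] by (intro continuous_intros)
    have GK: "G m x = 1" if "x \<in> K" for m x
      using that by (simp add: G_def)
    have G01: "G m x \<ge> 0" "G m x \<le> 1" for m x
      using e by (auto simp: G_def infdist_nonneg)
    have G0: "G m x = 0" if "x \<notin> {x. infdist x K \<le> e}" for m x
    proof -
      have "infdist x K \<le> real (Suc m) * infdist x K"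
        using mult_right_mono[of 1 "real (Suc m)" "infdist x K"] infdist_nonneg[of x K] by simp
      then have "e \<le> real (Suc m) * infdist x K"
        using that by simp
      then show ?thesis
        using e by (simp add: G_def field_simps)
    qed
    have nonpos: "(\<integral>y. w y * G m y \<partial>lborel) \<le> 0" for m
      by (rule integral_mult_continuous_nonpos_of_averages[OF w k_cont k_nonneg k_supp r k_pos avg
            Gc G01 G0 compact_infdist_le[OF False K(1) e(1)] e(2)]) auto
    have "(\<lambda>m. \<integral>y. w y * G m y \<partial>lborel) \<longlonglongrightarrow> (\<integral>y. w y * indicator K y \<partial>lborel)"
    proof (rule integral_dominated_convergence[where w = "\<lambda>y. \<bar>w y\<bar>"])
      show "AE y in lborel. norm (w y * G m y) \<le> \<bar>w y\<bar>" for m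
        using G01[of m] by (intro AE_I2) (auto simp: abs_mult intro: mult_left_le)
      show "AE y in lborel. (\<lambda>m. w y * G m y) \<longlonglongrightarrow> w y * indicator K y"
      proof (intro AE_I2 tendsto_intros)
        fix y
        show "(\<lambda>m. G m y) \<longlonglongrightarrow> indicator K y"
        proof (cases "y \<in> K")
          case False
          then have pos: "infdist y K > 0"
            using K \<open>K \<noteq> {}\<close> infdist_pos_not_in_closed compact_imp_closed by blast
          obtain m0 :: nat where m0: "e / infdist y K < real m0"
            using reals_Archimedean2 by blast
          have "G m y = 0" if "m \<ge> m0" for m
          proof -
            have "e / infdist y K < real (Suc m)"
              using m0 that by linarith
            then show ?thesis
              using e pos by (simp add: G_def field_simps)
          qed
          then have "\<forall>\<^sub>F m in sequentially. G m y = 0"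
            by (auto simp: eventually_sequentially)
          then show ?thesis
            using False by (simp add: tendsto_eventually)
        qed (simp add: GK)
      qed
      show "(\<lambda>y. w y * G m y) \<in> borel_measurable lborel" for m
        using borel_measurable_continuous_onI[OF Gc[of m]] by measurable
      show "(\<lambda>y. w y * indicator K y) \<in> borel_measurable lborel"
        using borel_compact[OF K(1)] by measurable
    qed (use w in auto)
    then show ?thesis
      using nonpos by (intro LIMSEQ_le_const2) auto
  qed simp
  define A where "A = {x \<in> S. w x > 0}"
  have "S \<in> sets borel"
    using S by simp
  then have [measurable]: "A \<in> sets borel"
    unfolding A_def by measurable
  \<comment> \<open>Up to a null set, the positivity set is a countable union of compact sets. On
    each of them \<open>w\<close> is positive with nonpositive integral, so each is null.\<close>
  obtain Z T where Z: "fsigma Z" "T \<in> null_sets lebesgue" "Z \<union> T = A"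
    by (rule lebesgue_set_almost_fsigma[of A]) auto
  then obtain F :: "nat \<Rightarrow> 'a set" where F: "range F \<subseteq> Collect compact" "Z = \<Union>(range F)"
    by (auto simp: fsigma_Union_compact)
  have "F n \<in> null_sets lebesgue" for n
  proof -
    have cF: "compact (F n)" and FA: "F n \<subseteq> A"
      using F Z by auto
    have [measurable]: "F n \<in> sets borel"
      using cF by (rule borel_compact)
    have int: "integrable lborel (\<lambda>y. w y * indicator (F n) y)"
      using w by (intro integrable_real_mult_indicator) auto
    have nn: "AE y in lborel. 0 \<le> w y * indicator (F n) y"
      using FA by (intro AE_I2) (auto simp: A_def indicator_def)
    have "(\<integral>y. w y * indicator (F n) y \<partial>lborel) \<le> 0"
      using FA cF by (intro compact_nonpos) (auto simp: A_def)
    then have "(\<integral>y. w y * indicator (F n) y \<partial>lborel) = 0"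
      using integral_nonneg_AE[OF nn] by linarith
    then have "AE y in lborel. w y * indicator (F n) y = 0"
      using integral_nonneg_eq_0_iff_AE[OF int nn] by simp
    then have "AE y in lborel. y \<notin> F n"
      using FA by (auto simp: A_def indicator_def elim!: eventually_mono split: if_splits)
    then have "F n \<in> null_sets lborel"
      by (simp add: AE_iff_null_sets)
    then show ?thesis
      by (rule null_sets_completionI)
  qed
  then have "Z \<in> null_sets lebesgue"
    unfolding F by (intro null_sets_UN) auto
  then have "A \<in> null_sets lebesgue"
    using Z by auto
  then have "A \<in> null_sets lborel"
    by (simp add: null_sets_completion_iff)
  then have "AE x in lborel. x \<notin> A"
    by (rule AE_not_in)
  then show ?thesis
    by eventually_elim (auto simp: A_def)
qed

text \<open>Fubini was applied to the product of \<open>lborel\<close> with itself. To reach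
  Lebesgue measurable functions, \<open>w\<close> is replaced by a Borel function equal to it almost
  everywhere; the kernels are continuous, so all pairings keep their values.\<close>

lemma AE_nonpos_of_averages:
  fixes w :: "'a::euclidean_space \<Rightarrow> real" and k :: "nat \<Rightarrow> 'a \<Rightarrow> real"
  assumes w: "integrable lebesgue w" and S: "open S"
    and k_cont: "\<And>n. continuous_on UNIV (k n)"
    and k_nonneg: "\<And>n z. k n z \<ge> 0"
    and k_supp: "\<And>n z. norm z \<ge> r n \<Longrightarrow> k n z = 0"
    and r: "r \<longlonglongrightarrow> 0"
    and k_pos: "\<And>n. (\<integral>z. k n z \<partial>lebesgue) > 0"
    and avg: "\<And>n x. x \<in> S \<Longrightarrow> (\<integral>y. w y * k n (y - x) \<partial>lebesgue) \<le> 0"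
  shows "AE x in lebesgue. x \<in> S \<longrightarrow> w x \<le> 0"
proof -
  obtain w' where w'[measurable]: "w' \<in> borel_measurable lborel" and "AE x in lborel. w x = w' x"
    using completion_ex_borel_measurable_real[OF borel_measurable_integrable[OF w]] by auto
  then have eq: "AE x in lebesgue. w x = w' x"
    using AE_completion by blast
  have [measurable]: "k n \<in> borel_measurable lborel" for n
    using borel_measurable_continuous_onI[OF k_cont] by simp
  have "integrable lebesgue w'"
    using integrable_cong_AE_imp[OF w _ eq] w' measurable_completion by blast
  then have i: "integrable lborel w'"
    by (simp add: integrable_completion)
  have avg': "(\<integral>y. w' y * k n (y - x) \<partial>lborel) \<le> 0" if "x \<in> S" for n x
  proof -
    have "(\<integral>y. w' y * k n (y - x) \<partial>lborel) = (\<integral>y. w' y * k n (y - x) \<partial>lebesgue)"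
      by (rule integral_completion[symmetric]) measurable
    also have "\<dots> = (\<integral>y. w y * k n (y - x) \<partial>lebesgue)"
    proof (rule integral_cong_AE)
      have [measurable]: "(\<lambda>y. k n (y - x)) \<in> borel_measurable lebesgue" for x
        by (intro measurable_completion) measurable
      show "(\<lambda>y. w' y * k n (y - x)) \<in> borel_measurable lebesgue"
        by (intro measurable_completion) measurable
      show "(\<lambda>y. w y * k n (y - x)) \<in> borel_measurable lebesgue"
        using borel_measurable_integrable[OF w] by measurable
      show "AE y in lebesgue. w' y * k n (y - x) = w y * k n (y - x)"
        using eq by eventually_elim simp
    qed
    finally show ?thesis
      using avg[OF that, of n] by simp
  qed
  have kp: "(\<integral>z. k n z \<partial>lborel) > 0" for n
    using k_pos[of n] by (simp add: integral_completion)
  have "AE x in lborel. x \<in> S \<longrightarrow> w' x \<le> 0"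
    by (rule AE_nonpos_of_averages_lborel[OF i S k_cont k_nonneg k_supp r kp avg']) auto
  then have "AE x in lebesgue. x \<in> S \<longrightarrow> w' x \<le> 0"
    by (rule AE_completion)
  with eq show ?thesis
    by eventually_elim simp
qed

section \<open>Local estimates for subsolutions\<close>

text \<open>Moves the weak formulations from \<Omega> to a compact set containing the support of the
  test function, where local integrability is plain integrability.\<close>

lemma set_integral_eq_integral_lebesgue_on:
  fixes g :: "'a::euclidean_space \<Rightarrow> 'b::euclidean_space"
  assumes "K \<in> sets lebesgue" "K \<subseteq> \<Omega>" "\<And>x. x \<notin> K \<Longrightarrow> g x = 0"
  shows "(LINT x:\<Omega>|lebesgue. g x) = integral\<^sup>L (lebesgue_on K) g"
proof -
  have "(LINT x:\<Omega>|lebesgue. g x) = (LINT x:K|lebesgue. g x)"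
    unfolding set_lebesgue_integral_def
    by (rule Bochner_Integration.integral_cong) (use assms in \<open>auto simp: indicator_def\<close>)
  then show ?thesis
    using assms(1) by (simp add: set_lebesgue_integral_def integral_restrict_space)
qed

text \<open>A non-integrable \<open>g\<close> has the junk integral \<open>0\<close>, for which the bound is also true.\<close>

lemma abs_integral_le_of_AE_bound:
  fixes g b :: "'a \<Rightarrow> real"
  assumes b: "integrable M b" and le: "AE x in M. \<bar>g x\<bar> \<le> b x"
  shows "\<bar>integral\<^sup>L M g\<bar> \<le> integral\<^sup>L M b"
proof -
  have nn: "AE x in M. 0 \<le> b x"
    using le by eventually_elim linarith
  have "AE x in M. g x \<le> b x" "AE x in M. - g x \<le> b x"
    using le by (eventually_elim, linarith)+
  from this[THEN integral_mono_AE'[OF b _ nn]] show ?thesis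
    by simp
qed

lemma integrable_on_compact_scaleR_continuous:
  fixes u :: "'a::euclidean_space \<Rightarrow> real" and g :: "'a \<Rightarrow> 'b::euclidean_space"
  assumes u: "integrable (lebesgue_on K) u" and K: "compact K" and g: "continuous_on UNIV g"
  shows "integrable (lebesgue_on K) (\<lambda>y. u y *\<^sub>R g y)"
proof -
  obtain B where B: "\<And>y. y \<in> K \<Longrightarrow> norm (g y) \<le> B"
    using compact_imp_bounded[OF compact_continuous_image[OF continuous_on_subset[OF g subset_UNIV] K]]
    by (auto simp: bounded_iff)
  have [measurable]: "g \<in> borel_measurable (lebesgue_on K)"
    using g K by (intro continuous_imp_measurable_on_sets_lebesgue)
      (auto intro: continuous_on_subset lmeasurable_compact fmeasurableD)
  show ?thesis
  proof (rule Bochner_Integration.integrable_bound)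
    show "integrable (lebesgue_on K) (\<lambda>y. \<bar>u y\<bar> * B)"
      using u by auto
    show "(\<lambda>y. u y *\<^sub>R g y) \<in> borel_measurable (lebesgue_on K)"
      using u by measurable
    show "AE y in lebesgue_on K. norm (u y *\<^sub>R g y) \<le> norm (\<bar>u y\<bar> * B)"
      by (rule AE_I2) (auto simp: abs_mult intro!: mult_left_mono order_trans[OF B])
  qed
qed

lemma integrable_on_compact_mult_continuous:
  fixes u g :: "'a::euclidean_space \<Rightarrow> real"
  assumes "integrable (lebesgue_on K) u" "compact K" "continuous_on UNIV g"
  shows "integrable (lebesgue_on K) (\<lambda>y. u y * g y)"
  using integrable_on_compact_scaleR_continuous[OF assms] by simp

section \<open>Local Lebesgue spaces restricted to compact sets\<close>

lemma Lp_norm_finite_iff: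
  "Lp_norm q S f < top \<longleftrightarrow> (\<integral>\<^sup>+ x. ennreal (norm (f x) powr q) \<partial>lebesgue_on S) < top"
  by (cases "(\<integral>\<^sup>+ x. ennreal (norm (f x) powr q) \<partial>lebesgue_on S) = top")
    (simp_all add: Lp_norm_def Let_def less_top)

lemma Lp_loc_measurable_on:
  assumes "f \<in> Lp_loc q \<Omega>" "K \<subseteq> \<Omega>"
  shows "f \<in> borel_measurable (lebesgue_on K)"
  by (rule measurable_restrict_mono[OF _ assms(2)]) (use assms(1) in \<open>simp add: Lp_loc_def\<close>)

lemma Lp_loc_integrable_powr:
  fixes f :: "'a::euclidean_space \<Rightarrow> 'b::euclidean_space"
  assumes "f \<in> Lp_loc q \<Omega>" "compact K" "K \<subseteq> \<Omega>"
  shows "integrable (lebesgue_on K) (\<lambda>x. norm (f x) powr q)"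
proof (rule integrableI_bounded)
  have [measurable]: "f \<in> borel_measurable (lebesgue_on K)"
    using assms Lp_loc_measurable_on by blast
  show "(\<lambda>x. norm (f x) powr q) \<in> borel_measurable (lebesgue_on K)"
    by measurable
  show "(\<integral>\<^sup>+ x. ennreal (norm (norm (f x) powr q)) \<partial>lebesgue_on K) < \<infinity>"
    using assms Lp_norm_finite_iff[of q K f] by (simp add: Lp_loc_def)
qed

lemma Lp_loc_1_integrable:
  fixes f :: "'a::euclidean_space \<Rightarrow> 'b::euclidean_space"
  assumes "f \<in> Lp_loc 1 \<Omega>" "compact K" "K \<subseteq> \<Omega>"
  shows "integrable (lebesgue_on K) f"
  using Lp_loc_integrable_powr[OF assms] integrable_norm_iff[OF Lp_loc_measurable_on[OF assms(1,3)]]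
  by simp

lemma integral_powr_le_Lp_norm:
  fixes f :: "'a::euclidean_space \<Rightarrow> 'b::euclidean_space"
  assumes q: "q > 0" and fin: "Lp_norm q S f < \<infinity>" and KS: "K \<subseteq> S"
    and S: "S \<in> sets lebesgue" and K: "K \<in> sets lebesgue"
  shows "(\<integral>x. norm (f x) powr q \<partial>lebesgue_on K) \<le> enn2real (Lp_norm q S f) powr q"
proof -
  define I where "I = (\<integral>\<^sup>+ x. ennreal (norm (f x) powr q) \<partial>lebesgue_on S)"
  have I: "I < \<infinity>"
    using fin by (simp add: Lp_norm_finite_iff I_def)
  have "(\<integral>\<^sup>+ x. ennreal (norm (f x) powr q) \<partial>lebesgue_on K) \<le> I"
    unfolding I_def using K S KS
    by (subst (1 2) nn_integral_restrict_space) (auto intro!: nn_integral_mono simp: indicator_def)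
  then have "enn2real (\<integral>\<^sup>+ x. ennreal (norm (f x) powr q) \<partial>lebesgue_on K) \<le> enn2real I"
    using I by (intro enn2real_mono) auto
  moreover have "(\<integral>x. norm (f x) powr q \<partial>lebesgue_on K) \<le>
      enn2real (\<integral>\<^sup>+ x. ennreal (norm (f x) powr q) \<partial>lebesgue_on K)"
  proof (cases "integrable (lebesgue_on K) (\<lambda>x. norm (f x) powr q)")
    case True
    then have "(\<integral>x. norm (f x) powr q \<partial>lebesgue_on K) =
        enn2real (\<integral>\<^sup>+ x. ennreal (norm (f x) powr q) \<partial>lebesgue_on K)"
      by (intro integral_eq_nn_integral borel_measurable_integrable AE_I2) auto
    then show ?thesis
      by simp
  next
    case False
    then show ?thesis
      by (simp add: not_integrable_integral_eq)
  qed
  moreover have "enn2real (Lp_norm q S f) powr q = enn2real I"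
    using I q by (simp add: Lp_norm_def Let_def I_def[symmetric] powr_powr)
  ultimately show ?thesis
    by simp
qed

lemma grad_eq_0_outside:
  assumes "\<And>y. y \<notin> cball x s \<Longrightarrow> \<phi> y = 0" "y \<notin> cball x s"
  shows "grad \<phi> y = 0"
proof -
  have "(\<phi> has_derivative (\<lambda>h. 0)) (at y)"
    by (rule has_derivative_transform_within_open[of "\<lambda>_. 0" _ _ _ "- cball x s"])
      (use assms in \<open>auto simp del: mem_cball\<close>)
  then show ?thesis
    by (simp add: grad_def vec_eq_iff partial_deriv_eq)
qed

lemma continuous_grad: "Ck (Suc 0) \<phi> \<Longrightarrow> continuous_on UNIV (grad \<phi>)"
  unfolding grad_def [abs_def] by (intro continuous_on_vec_lambda) simp

text \<open>Stands in for Hoelder's inequality. For the datum and the radial flux it is applied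
  after rescaling by a power of \<open>s\<close>, chosen so that the two resulting terms have the
  required size.\<close>

lemma le_one_plus_powr:
  fixes y r :: real
  assumes "y \<ge> 0" "r \<ge> 1"
  shows "y \<le> 1 + y powr r"
proof (cases "y \<le> 1")
  case False
  then have "y powr 1 \<le> y powr r"
    using assms by (intro powr_mono) auto
  then show ?thesis
    using False by simp
qed (simp add: add_increasing2)

text \<open>Absorbs the flux term: half of the p-th power remains for the other side, and the price
  is quadratic in \<open>b\<close>. As \<open>b\<close> will be of order 1/s, this is the source of
  the 2 in the definition of \<kappa>.\<close>

lemma linear_growth_le_powr:
  fixes b X p :: real
  assumes b: "b \<ge> 0" and X: "X \<ge> 0" and p: "p \<ge> 2"
  shows "b + b * X \<le> X powr p / 2 + (1 + 2 * b\<^sup>2)"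
proof -
  have "X\<^sup>2 \<le> 1 + (X\<^sup>2) powr (p / 2)"
    using p by (intro le_one_plus_powr) auto
  also have "(X\<^sup>2) powr (p / 2) = X powr p"
  proof (cases "X = 0")
    case False
    then have "X\<^sup>2 = X powr 2"
      using X by simp
    then show ?thesis
      by (simp only: powr_powr) simp
  qed simp
  finally have 1: "X\<^sup>2 \<le> 1 + X powr p" .
  have 2: "b * X \<le> X\<^sup>2 / 4 + b\<^sup>2"
    using zero_le_power2[of "X / 2 - b"] by (simp add: power2_eq_square algebra_simps)
  have 3: "b \<le> 1 / 2 + b\<^sup>2 / 2"
    using zero_le_power2[of "1 - b"] by (simp add: power2_eq_square algebra_simps)
  have "X powr p \<ge> 0" "b\<^sup>2 \<ge> 0"
    by auto
  with 1 2 3 show ?thesis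
    by linarith
qed

lemma cutoff_translate: "cutoff x s y = cutoff 0 s (y - x)"
  by (simp add: cutoff_def)

lemma integral_cutoff_ge:
  fixes x :: "real ^ 'n::finite"
  assumes s: "s > 0"
  shows "integrable lebesgue (cutoff x s)"
    and "exp (- 2) * (unit_ball_vol (real CARD('n)) * (s / 2) ^ CARD('n)) \<le> (\<integral>y. cutoff x s y \<partial>lebesgue)"
proof -
  show int: "integrable lebesgue (cutoff x s)"
  proof (rule integrableI_bounded_set[where A = "cball x s" and B = 1])
    show "cutoff x s \<in> borel_measurable lebesgue"
      using borel_measurable_continuous_onI[OF continuous_cutoff] by (intro measurable_completion) simp
    show "emeasure lebesgue (cball x s) < \<infinity>"
      using emeasure_compact_finite[of "cball x s"] by simp
    show "AE y in lebesgue. y \<in> cball x s \<longrightarrow> norm (cutoff x s y) \<le> 1"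
      by (rule AE_I2) (use cutoff_nonneg[of x s] cutoff_le_1[of x s] in \<open>simp add: abs_of_nonneg\<close>)
    show "AE y in lebesgue. y \<notin> cball x s \<longrightarrow> cutoff x s y = 0"
      by (rule AE_I2) (use cutoff_eq_0(1)[OF s, of _ x] in \<open>simp add: dist_norm norm_minus_commute\<close>)
  qed simp
  have em: "emeasure lebesgue (ball x (s / 2)) = ennreal (unit_ball_vol (real CARD('n)) * (s / 2) ^ CARD('n))"
    using s by (simp add: emeasure_ball)
  have "exp (- 2) * (unit_ball_vol (real CARD('n)) * (s / 2) ^ CARD('n)) =
      (\<integral>y. exp (- 2) * indicator (ball x (s / 2)) y \<partial>lebesgue)"
    using em s by (simp add: measure_def)
  also have "\<dots> \<le> (\<integral>y. cutoff x s y \<partial>lebesgue)"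
  proof (rule integral_mono_AE'[OF int])
    show "AE y in lebesgue. exp (- 2) * indicator (ball x (s / 2)) y \<le> cutoff x s y"
    proof (rule AE_I2)
      fix y
      show "exp (- 2) * indicator (ball x (s / 2)) y \<le> cutoff x s y"
        using cutoff_ge[OF s, of y x] cutoff_nonneg[of x s y]
        by (cases "y \<in> ball x (s / 2)") (simp_all add: dist_norm norm_minus_commute)
    qed
    show "AE y in lebesgue. 0 \<le> cutoff x s y"
      by (rule AE_I2) (rule cutoff_nonneg)
  qed
  finally show "exp (- 2) * (unit_ball_vol (real CARD('n)) * (s / 2) ^ CARD('n)) \<le> (\<integral>y. cutoff x s y \<partial>lebesgue)" .
qed

section \<open>Energy and flux bounds on small balls\<close>

locale local_subsolution =
  fixes \<Omega> K :: "(real ^ 'n::finite) set" and a :: "real ^ 'n \<Rightarrow> real \<Rightarrow> real ^ 'n \<Rightarrow> real ^ 'n"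
    and \<beta> p q lam :: real and f u :: "real ^ 'n \<Rightarrow> real" and Du :: "real ^ 'n \<Rightarrow> real ^ 'n"
    and V :: real
  defines V_def: "V \<equiv> unit_ball_vol (real CARD('n))"
  assumes compact_K: "compact K" and K_subset: "K \<subseteq> \<Omega>" and open_\<Omega>: "open \<Omega>"
    and \<beta>: "\<beta> > 0"
    and growth: "AE x in lebesgue_on \<Omega>. \<forall>s \<xi>. norm (a x s \<xi>) \<le> \<beta> * (1 + norm \<xi>)"
    and p: "p > 2" and lam: "lam > 0" and q: "q \<ge> 1" "q > real CARD('n) / p"
    and f: "f \<in> Lp_loc q \<Omega>" and u: "in_W1p_loc p \<Omega> u Du"
    and subsolution: "distr_subsolution \<Omega> a lam p f u Du"
begin

abbreviation "M \<equiv> lebesgue_on K"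

text \<open>The product \<kappa> p is the worse of the two losses relative to the volume s^N:
  s^(-N/q) from \<open>f\<close> and s^(-2) from the gradient of the cutoff.\<close>

definition \<kappa> :: real
  where "\<kappa> = max (real CARD('n) / q) 2 / p"

text \<open>The outer 2 undoes the absorption of half the gradient term. One \<open>V\<close> and
  the integral of |f|^q come from the datum, the other \<open>V\<close> and 128 = 2 * 8^2 from
  \<open>1 + 2 * b\<^sup>2\<close> with b = 8 \<beta> / s.\<close>

definition energy_const :: real
  where "energy_const = 2 * (2 * V + (\<integral>y. \<bar>f y\<bar> powr q \<partial>M) + 128 * \<beta>\<^sup>2 * V)"

lemma \<kappa>_bounds: "0 < \<kappa>" "\<kappa> < 1" "\<kappa> * p \<ge> real CARD('n) / q" "\<kappa> * p \<ge> 2"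
proof -
  have "real CARD('n) / q < p"
    using p q by (simp add: field_simps)
  then show "\<kappa> < 1"
    using p by (simp add: \<kappa>_def)
  show "0 < \<kappa>"
    using p by (simp add: \<kappa>_def less_max_iff_disj)
  show "\<kappa> * p \<ge> real CARD('n) / q" "\<kappa> * p \<ge> 2"
    using p by (simp_all add: \<kappa>_def)
qed

lemma V_pos: "V > 0"
  by (simp add: V_def)

lemma energy_const_nonneg: "energy_const \<ge> 0"
proof -
  have "0 \<le> (\<integral>y. \<bar>f y\<bar> powr q \<partial>M)"
    by (rule integral_nonneg_AE) simp
  then show ?thesis
    using V_pos by (simp add: energy_const_def)
qed

lemma K_sets: "K \<in> sets lebesgue"
  by (intro fmeasurableD lmeasurable_compact compact_K)

lemma u_integrable: "integrable M u"
  by (rule Lp_loc_1_integrable[OF _ compact_K K_subset])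
    (use u in \<open>simp add: in_W1p_loc_def has_weak_gradient_def\<close>)

lemma Du_integrable: "integrable M Du"
  by (rule Lp_loc_1_integrable[OF _ compact_K K_subset])
    (use u in \<open>simp add: in_W1p_loc_def has_weak_gradient_def\<close>)

lemma Du_powr_integrable: "integrable M (\<lambda>y. norm (Du y) powr p)"
  by (rule Lp_loc_integrable_powr[OF _ compact_K K_subset]) (use u in \<open>simp add: in_W1p_loc_def\<close>)

lemma f_powr_integrable: "integrable M (\<lambda>y. \<bar>f y\<bar> powr q)"
  using Lp_loc_integrable_powr[OF f compact_K K_subset] by simp

lemma growth_K: "AE x in M. \<forall>s \<xi>. norm (a x s \<xi>) \<le> \<beta> * (1 + norm \<xi>)"
proof -
  have "AE x in lebesgue. x \<in> \<Omega> \<longrightarrow> (\<forall>s \<xi>. norm (a x s \<xi>) \<le> \<beta> * (1 + norm \<xi>))"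
    using growth open_\<Omega> by (subst (asm) AE_restrict_space_iff) auto
  then have "AE x in lebesgue. x \<in> K \<longrightarrow> (\<forall>s \<xi>. norm (a x s \<xi>) \<le> \<beta> * (1 + norm \<xi>))"
    using K_subset by (auto elim!: eventually_mono)
  then show ?thesis
    using K_sets by (subst AE_restrict_space_iff) auto
qed

lemma ball_indicator_integral:
  assumes "s > 0" "ball x s \<subseteq> K"
  shows "integrable M (indicator (ball x s) :: _ \<Rightarrow> real)"
    and "(\<integral>y. indicator (ball x s) y \<partial>M) = V * s ^ CARD('n)"
proof -
  have b: "ball x s \<in> sets M"
    using assms K_sets by (auto simp: sets_restrict_space_iff)
  have e: "emeasure M (ball x s) = emeasure lebesgue (ball x s)"
    using assms K_sets by (intro emeasure_restrict_space) auto
  have "emeasure lebesgue (ball x s) = ennreal (V * s ^ CARD('n))"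
    using assms by (simp add: emeasure_ball V_def)
  with e have e': "emeasure M (ball x s) = ennreal (V * s ^ CARD('n))"
    by simp
  show "integrable M (indicator (ball x s) :: _ \<Rightarrow> real)"
    using b e' by (simp add: integrable_indicator_iff Int_absorb2[OF assms(2)])
  have "ball x s \<inter> space M = ball x s"
    using assms by (auto simp: space_restrict_space)
  then show "(\<integral>y. indicator (ball x s) y \<partial>M) = V * s ^ CARD('n)"
    using e' assms V_pos by (simp add: measure_def)
qed

lemma cutoff_eq_0_outside: "s > 0 \<Longrightarrow> y \<notin> cball x s \<Longrightarrow> cutoff x s y = 0"
  using cutoff_eq_0[of s y x] by (simp add: dist_norm norm_minus_commute)

lemma energy_estimate:
  assumes s: "0 < s" "s \<le> 1" and sub: "cball x s \<subseteq> K"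
    and pos: "(\<integral>y. u y * cutoff x s y \<partial>M) \<ge> 0"
  shows "(\<integral>y. norm (Du y) powr p * cutoff x s y \<partial>M) \<le> energy_const * s powr (real CARD('n) - \<kappa> * p)"
proof -
  let ?N = "real CARD('n)"
  let ?\<phi> = "cutoff x s" and ?\<chi> = "indicator (ball x s) :: real ^ 'n \<Rightarrow> real"
  define P where "P = (\<integral>y. norm (Du y) powr p * ?\<phi> y \<partial>M)"
  define Fq where "Fq = (\<integral>y. \<bar>f y\<bar> powr q \<partial>M)"
  define b where "b = 8 * \<beta> / s"
  have b: "b \<ge> 0"
    using \<beta> s by (simp add: b_def)
  have zero: "\<And>y. y \<notin> K \<Longrightarrow> ?\<phi> y = 0" "\<And>y. y \<notin> K \<Longrightarrow> grad ?\<phi> y = 0"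
    using sub cutoff_eq_0_outside[OF s(1)] grad_eq_0_outside[of x s ?\<phi>] by blast+
  have ball: "ball x s \<subseteq> K"
    using sub ball_subset_cball by blast
  note ind = ball_indicator_integral[OF s(1) ball]
  note powers = powr_realpow[OF s(1), symmetric]
  have P_int: "integrable M (\<lambda>y. norm (Du y) powr p * ?\<phi> y)"
    by (rule integrable_on_compact_mult_continuous[OF Du_powr_integrable compact_K continuous_cutoff])
  have weak: "(\<integral>y. a y (u y) (Du y) \<bullet> grad ?\<phi> y \<partial>M) + lam * (\<integral>y. u y * ?\<phi> y \<partial>M) + P
      \<le> (\<integral>y. f y * ?\<phi> y \<partial>M)"
  proof -
    have "?\<phi> \<in> test_functions \<Omega>"
      using s sub K_subset by (intro cutoff_test_function) auto
    moreover have "\<forall>y. ?\<phi> y \<ge> 0"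
      by (simp add: cutoff_nonneg)
    ultimately have "(LINT y:\<Omega>|lebesgue. a y (u y) (Du y) \<bullet> grad ?\<phi> y)
      + lam * (LINT y:\<Omega>|lebesgue. u y * ?\<phi> y)
      + (LINT y:\<Omega>|lebesgue. norm (Du y) powr p * ?\<phi> y)
      \<le> (LINT y:\<Omega>|lebesgue. f y * ?\<phi> y)"
      using subsolution unfolding distr_subsolution_def by blast
    then show ?thesis
      unfolding P_def by (subst (asm) (1 2 3 4) set_integral_eq_integral_lebesgue_on[OF K_sets K_subset])
        (auto simp: zero)
  qed
  have A: "\<bar>\<integral>y. a y (u y) (Du y) \<bullet> grad ?\<phi> y \<partial>M\<bar> \<le> P / 2 + (1 + 2 * b\<^sup>2) * (V * s ^ CARD('n))"
  proof -
    have "\<bar>\<integral>y. a y (u y) (Du y) \<bullet> grad ?\<phi> y \<partial>M\<bar> \<le>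
        (\<integral>y. norm (Du y) powr p * ?\<phi> y / 2 + (1 + 2 * b\<^sup>2) * ?\<chi> y \<partial>M)"
    proof (rule abs_integral_le_of_AE_bound)
      show "integrable M (\<lambda>y. norm (Du y) powr p * ?\<phi> y / 2 + (1 + 2 * b\<^sup>2) * ?\<chi> y)"
        using P_int ind(1) by auto
      show "AE y in M. \<bar>a y (u y) (Du y) \<bullet> grad ?\<phi> y\<bar> \<le> norm (Du y) powr p * ?\<phi> y / 2 + (1 + 2 * b\<^sup>2) * ?\<chi> y"
        using growth_K
      proof eventually_elim
        fix y
        assume gr: "\<forall>s \<xi>. norm (a y s \<xi>) \<le> \<beta> * (1 + norm \<xi>)"
        \<comment> \<open>The p-th root of the integrand |Du|^p \<phi>; the flat gradient bound
          makes the flux linear in exactly this quantity.\<close>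
        define X where "X = norm (Du y) * ?\<phi> y powr (1 / p)"
        have "\<bar>a y (u y) (Du y) \<bullet> grad ?\<phi> y\<bar> \<le> norm (a y (u y) (Du y)) * norm (grad ?\<phi> y)"
          by (rule Cauchy_Schwarz_ineq2)
        also have "\<dots> \<le> (\<beta> * (1 + norm (Du y))) * (8 / s * ?\<phi> y powr (1 / p))"
          using gr s p \<beta> by (intro mult_mono norm_grad_cutoff_le) auto
        also have "\<dots> = b * ?\<phi> y powr (1 / p) + b * X"
          by (simp add: b_def X_def algebra_simps add_divide_distrib)
        finally have 1: "\<bar>a y (u y) (Du y) \<bullet> grad ?\<phi> y\<bar> \<le> b * ?\<phi> y powr (1 / p) + b * X" .
        have Xp: "X powr p = norm (Du y) powr p * ?\<phi> y"
          using p cutoff_nonneg[of x s y] by (simp add: X_def powr_mult powr_powr)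
        show "\<bar>a y (u y) (Du y) \<bullet> grad ?\<phi> y\<bar> \<le> norm (Du y) powr p * ?\<phi> y / 2 + (1 + 2 * b\<^sup>2) * ?\<chi> y"
        proof (cases "y \<in> ball x s")
          case True
          have "?\<phi> y powr (1 / p) \<le> 1"
            using cutoff_nonneg[of x s y] cutoff_le_1[of x s y] p by (intro powr_le1) auto
          then have "b * ?\<phi> y powr (1 / p) \<le> b"
            using b by (intro mult_left_le) auto
          with 1 show ?thesis
            using True linear_growth_le_powr[OF b, of X p] p by (simp add: Xp X_def[symmetric]) (simp add: X_def)
        next
          case False
          then have "?\<phi> y = 0"
            using cutoff_eq_0[OF s(1), of y x] by (simp add: dist_norm norm_minus_commute)
          with 1 False show ?thesis
            by (simp add: X_def)
        qed
      qed
    qed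
    also have "\<dots> = P / 2 + (1 + 2 * b\<^sup>2) * (V * s ^ CARD('n))"
      using P_int ind by (simp add: P_def)
    finally show ?thesis .
  qed
  have F: "(\<integral>y. f y * ?\<phi> y \<partial>M) \<le> (V + Fq) * s powr (?N - ?N / q)"
  proof -
    have "(\<integral>y. f y * ?\<phi> y \<partial>M) \<le> (\<integral>y. s powr (- ?N / q) * (?\<chi> y + s ^ CARD('n) * \<bar>f y\<bar> powr q) \<partial>M)"
    proof (rule order_trans[OF abs_ge_self], rule abs_integral_le_of_AE_bound, goal_cases)
      case 1
      show ?case
        using f_powr_integrable ind(1) by auto
    next
      case 2
      show ?case
      proof (rule AE_I2)
        fix y
        \<comment> \<open>The factor s^(N/q) becomes s^N after the q-th power, which matches the
          volume of the ball on which the summand 1 is integrated.\<close>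
        have "s powr (?N / q) * \<bar>f y\<bar> \<le> 1 + (s powr (?N / q) * \<bar>f y\<bar>) powr q"
          using q by (intro le_one_plus_powr) auto
        also have "\<dots> = 1 + s ^ CARD('n) * \<bar>f y\<bar> powr q"
          using q s by (simp add: powr_mult powr_powr powers)
        finally have "s powr (- ?N / q) * (s powr (?N / q) * \<bar>f y\<bar>) \<le>
            s powr (- ?N / q) * (1 + s ^ CARD('n) * \<bar>f y\<bar> powr q)"
          by (rule mult_left_mono) simp
        moreover have "s powr (- ?N / q) * (s powr (?N / q) * \<bar>f y\<bar>) = \<bar>f y\<bar>"
          using s by (simp flip: mult.assoc powr_add)
        ultimately have *: "\<bar>f y\<bar> \<le> s powr (- ?N / q) * (1 + s ^ CARD('n) * \<bar>f y\<bar> powr q)"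
          by (simp only:)
        show "\<bar>f y * ?\<phi> y\<bar> \<le> s powr (- ?N / q) * (?\<chi> y + s ^ CARD('n) * \<bar>f y\<bar> powr q)"
        proof (cases "y \<in> ball x s")
          case True
          have "\<bar>f y * ?\<phi> y\<bar> \<le> \<bar>f y\<bar>"
            using cutoff_nonneg[of x s y] cutoff_le_1[of x s y] by (simp add: abs_mult mult_left_le)
          with * True show ?thesis
            by simp
        next
          case False
          then have "?\<phi> y = 0"
            using cutoff_eq_0[OF s(1), of y x] by (simp add: dist_norm norm_minus_commute)
          then show ?thesis
            using False s by simp
        qed
      qed
    qed
    also have "\<dots> = s powr (- ?N / q) * (V * s ^ CARD('n) + s ^ CARD('n) * Fq)"
      using ind f_powr_integrable by (simp add: Fq_def)
    also have "\<dots> = (V + Fq) * (s powr (- ?N / q) * s powr ?N)"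
      by (simp add: powers algebra_simps)
    also have "s powr (- ?N / q) * s powr ?N = s powr (?N - ?N / q)"
      by (simp flip: powr_add)
    finally show ?thesis .
  qed
  have "lam * (\<integral>y. u y * ?\<phi> y \<partial>M) \<ge> 0"
    using lam pos by simp
  with weak A F have "P \<le> 2 * ((V + Fq) * s powr (?N - ?N / q) + (1 + 2 * b\<^sup>2) * (V * s ^ CARD('n)))"
    by (simp add: abs_le_iff)
  also have "(1 + 2 * b\<^sup>2) * (V * s ^ CARD('n)) = V * s powr ?N + 128 * \<beta>\<^sup>2 * V * s powr (?N - 2)"
  proof -
    have "s powr ?N = s ^ CARD('n)"
      using s by (intro powr_realpow)
    moreover from this have "s powr (?N - 2) = s ^ CARD('n) / s\<^sup>2"
      using s by (simp add: powr_diff)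
    ultimately show ?thesis
      by (simp only: b_def power_mult_distrib power_divide) (simp add: algebra_simps)
  qed
  also have "2 * ((V + Fq) * s powr (?N - ?N / q) + (V * s powr ?N + 128 * \<beta>\<^sup>2 * V * s powr (?N - 2)))
      \<le> 2 * ((V + Fq) * s powr (?N - \<kappa> * p) + (V * s powr (?N - \<kappa> * p) + 128 * \<beta>\<^sup>2 * V * s powr (?N - \<kappa> * p)))"
  proof -
    have "Fq \<ge> 0"
      unfolding Fq_def by (rule integral_nonneg_AE) simp
    \<comment> \<open>Because s is at most 1, the smallest exponent gives the largest power, and
      \<kappa> was chosen so that N - \<kappa> p is below all three.\<close>
    moreover have "s powr (?N - ?N / q) \<le> s powr (?N - \<kappa> * p)" "s powr ?N \<le> s powr (?N - \<kappa> * p)"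
        "s powr (?N - 2) \<le> s powr (?N - \<kappa> * p)"
      using s \<kappa>_bounds by (auto intro!: powr_mono')
    ultimately show ?thesis
      using V_pos by (intro mult_left_mono add_mono) auto
  qed
  also have "\<dots> = energy_const * s powr (?N - \<kappa> * p)"
    by (simp add: energy_const_def Fq_def algebra_simps)
  finally show ?thesis
    by (simp add: P_def)
qed

text \<open>Rescaling by s^\<kappa> gives |Du| <= s^(-\<kappa>) + s^(\<kappa>(p-1)) |Du|^p. After
  weighting with \<phi> and integrating, the energy estimate turns both summands into multiples of
  s^(N-\<kappa>); the remaining factor \<open>s\<close> is the bound for |y - x|.\<close>

lemma radial_flux_estimate:
  assumes s: "0 < s" "s \<le> 1" and sub: "cball x s \<subseteq> K"
    and pos: "(\<integral>y. u y * cutoff x s y \<partial>M) \<ge> 0"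
  shows "\<bar>\<integral>y. cutoff x s y * ((y - x) \<bullet> Du y) \<partial>M\<bar>
    \<le> (V + energy_const) * s powr (real CARD('n) + 1 - \<kappa>)"
proof -
  let ?N = "real CARD('n)"
  let ?\<phi> = "cutoff x s" and ?\<chi> = "indicator (ball x s) :: real ^ 'n \<Rightarrow> real"
  define P where "P = (\<integral>y. norm (Du y) powr p * ?\<phi> y \<partial>M)"
  have ball: "ball x s \<subseteq> K"
    using sub ball_subset_cball by blast
  note ind = ball_indicator_integral[OF s(1) ball]
  have P_int: "integrable M (\<lambda>y. norm (Du y) powr p * ?\<phi> y)"
    by (rule integrable_on_compact_mult_continuous[OF Du_powr_integrable compact_K continuous_cutoff])
  have "\<bar>\<integral>y. ?\<phi> y * ((y - x) \<bullet> Du y) \<partial>M\<bar> \<le>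
      (\<integral>y. s * (s powr - \<kappa> * ?\<chi> y + s powr (\<kappa> * (p - 1)) * (norm (Du y) powr p * ?\<phi> y)) \<partial>M)"
  proof (rule abs_integral_le_of_AE_bound)
    show "integrable M (\<lambda>y. s * (s powr - \<kappa> * ?\<chi> y + s powr (\<kappa> * (p - 1)) * (norm (Du y) powr p * ?\<phi> y)))"
      using P_int ind(1) by auto
    show "AE y in M. \<bar>?\<phi> y * ((y - x) \<bullet> Du y)\<bar> \<le>
        s * (s powr - \<kappa> * ?\<chi> y + s powr (\<kappa> * (p - 1)) * (norm (Du y) powr p * ?\<phi> y))"
    proof (rule AE_I2)
      fix y
      show "\<bar>?\<phi> y * ((y - x) \<bullet> Du y)\<bar> \<le>
        s * (s powr - \<kappa> * ?\<chi> y + s powr (\<kappa> * (p - 1)) * (norm (Du y) powr p * ?\<phi> y))"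
      proof (cases "y \<in> ball x s")
        case True
        define d where "d = norm (Du y)"
        have "\<bar>(y - x) \<bullet> Du y\<bar> \<le> norm (y - x) * d"
          unfolding d_def by (rule Cauchy_Schwarz_ineq2)
        also have "\<dots> \<le> s * d"
          using True by (intro mult_right_mono) (auto simp: dist_norm norm_minus_commute d_def)
        finally have "\<bar>(y - x) \<bullet> Du y\<bar> \<le> s * d" .
        then have 1: "\<bar>?\<phi> y * ((y - x) \<bullet> Du y)\<bar> \<le> ?\<phi> y * (s * d)"
          using cutoff_nonneg[of x s y] by (simp add: abs_mult mult_left_mono)
        have "s powr \<kappa> * d \<le> 1 + (s powr \<kappa> * d) powr p"
          using p by (intro le_one_plus_powr) (auto simp: d_def)
        then have "s powr - \<kappa> * (s powr \<kappa> * d) \<le> s powr - \<kappa> * (1 + (s powr \<kappa> * d) powr p)"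
          by (rule mult_left_mono) simp
        moreover have "s powr - \<kappa> * (s powr \<kappa> * d) = d"
          using s by (simp flip: mult.assoc powr_add)
        moreover have "s powr - \<kappa> * (1 + (s powr \<kappa> * d) powr p) =
            s powr - \<kappa> + (s powr - \<kappa> * s powr (\<kappa> * p)) * d powr p"
          by (simp add: powr_mult powr_powr d_def algebra_simps)
        moreover have "s powr - \<kappa> * s powr (\<kappa> * p) = s powr (\<kappa> * (p - 1))"
          by (simp flip: powr_add add: algebra_simps)
        ultimately have "d \<le> s powr - \<kappa> + s powr (\<kappa> * (p - 1)) * d powr p"
          by simp
        then have "?\<phi> y * d \<le> ?\<phi> y * (s powr - \<kappa> + s powr (\<kappa> * (p - 1)) * d powr p)"
          using cutoff_nonneg[of x s y] by (rule mult_left_mono)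
        also have "\<dots> = ?\<phi> y * s powr - \<kappa> + s powr (\<kappa> * (p - 1)) * (d powr p * ?\<phi> y)"
          by (simp add: algebra_simps)
        also have "?\<phi> y * s powr - \<kappa> \<le> s powr - \<kappa>"
          using cutoff_nonneg[of x s y] cutoff_le_1[of x s y] by (intro mult_left_le_one_le) auto
        finally have "s * (?\<phi> y * d) \<le> s * (s powr - \<kappa> + s powr (\<kappa> * (p - 1)) * (d powr p * ?\<phi> y))"
          using s by (intro mult_left_mono) auto
        with 1 True show ?thesis
          by (simp add: d_def mult_ac)
      next
        case False
        then have "?\<phi> y = 0"
          using cutoff_eq_0[OF s(1), of y x] by (simp add: dist_norm norm_minus_commute)
        then show ?thesis
          using False s by simp
      qed
    qed
  qed
  also have "\<dots> = s * (s powr - \<kappa> * (V * s ^ CARD('n)) + s powr (\<kappa> * (p - 1)) * P)"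
    using P_int ind by (simp add: P_def)
  also have "\<dots> \<le> s * (s powr - \<kappa> * (V * s ^ CARD('n))
      + s powr (\<kappa> * (p - 1)) * (energy_const * s powr (?N - \<kappa> * p)))"
    unfolding P_def using s by (intro mult_left_mono add_left_mono energy_estimate[OF s sub pos]) auto
  also have "\<dots> = V * (s * s powr - \<kappa> * s powr ?N)
      + energy_const * (s * (s powr (\<kappa> * (p - 1)) * s powr (?N - \<kappa> * p)))"
    using powr_realpow[OF s(1)] by (simp add: algebra_simps)
  also have "s powr (\<kappa> * (p - 1)) * s powr (?N - \<kappa> * p) = s powr - \<kappa> * s powr ?N"
    by (simp flip: powr_add add: algebra_simps)
  also have "s * (s powr - \<kappa> * s powr ?N) = s powr (?N + 1 - \<kappa>)"
    using s by (simp add: powr_add powr_diff powr_minus field_simps)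
  also have "s * s powr - \<kappa> * s powr ?N = s powr (?N + 1 - \<kappa>)"
    using s by (simp add: powr_add powr_diff powr_minus field_simps)
  finally show ?thesis
    by (simp add: algebra_simps)
qed

text \<open>The weak gradient identity is stated for scalar test functions, so the radial field is
  tested one coordinate at a time: (y_i - x_i) \<phi> is inserted, the i-th component of the
  resulting vector identity is kept, and the components are summed.\<close>

lemma integral_radial_div:
  assumes s: "0 < s" and sub: "cball x s \<subseteq> K"
  shows "(\<integral>y. u y * radial_div x s y \<partial>M) = - (\<integral>y. cutoff x s y * ((y - x) \<bullet> Du y) \<partial>M)"
proof -
  define \<psi> where "\<psi> i y = (y $ i - x $ i) * cutoff x s y" for i y
  have Ck\<psi>: "Ck k (\<psi> i)" for k i
    unfolding \<psi>_def [abs_def] by (intro Ck_mult Ck_nth_diff Ck_cutoff)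
  have \<psi>0: "\<psi> i y = 0" if "y \<notin> cball x s" for i y
    using cutoff_eq_0_outside[OF s that] by (simp add: \<psi>_def)
  have \<psi>_cont: "continuous_on UNIV (\<psi> i)" for i
    using Ck\<psi>[of 0 i] by simp
  have int1: "integrable M (\<lambda>y. u y *\<^sub>R grad (\<psi> i) y)" for i
    by (intro integrable_on_compact_scaleR_continuous u_integrable compact_K continuous_grad Ck\<psi>)
  have int2: "integrable M (\<lambda>y. Du y $ i * \<psi> i y)" for i
    by (intro integrable_on_compact_mult_continuous compact_K \<psi>_cont
        integrable_bounded_linear[OF bounded_linear_vec_nth Du_integrable])
  have int3: "integrable M (\<lambda>y. \<psi> i y *\<^sub>R Du y)" for i
  proof -
    have "bounded (\<psi> i ` K)"
      by (intro compact_imp_bounded compact_continuous_image compact_K continuous_on_subset[OF \<psi>_cont]) auto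
    then obtain B where B: "\<And>y. y \<in> K \<Longrightarrow> norm (\<psi> i y) \<le> B"
      by (auto simp: bounded_iff)
    have [measurable]: "\<psi> i \<in> borel_measurable M"
      using \<psi>_cont K_sets by (intro continuous_imp_measurable_on_sets_lebesgue) (auto intro: continuous_on_subset)
    show ?thesis
    proof (rule Bochner_Integration.integrable_bound)
      show "integrable M (\<lambda>y. B *\<^sub>R Du y)"
        using Du_integrable by auto
      show "(\<lambda>y. \<psi> i y *\<^sub>R Du y) \<in> borel_measurable M"
        using Du_integrable by measurable
      show "AE y in M. norm (\<psi> i y *\<^sub>R Du y) \<le> norm (B *\<^sub>R Du y)"
        by (rule AE_I2) (auto intro!: mult_right_mono order_trans[OF B[unfolded real_norm_def]])
    qed
  qed
  have comp: "(\<integral>y. u y * partial_deriv i (\<psi> i) y \<partial>M) = - (\<integral>y. \<psi> i y * Du y $ i \<partial>M)" for i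
  proof -
    have "\<psi> i \<in> test_functions \<Omega>"
      using cutoff_test_function(2)[OF s, of x \<Omega> i] sub K_subset by (auto simp: \<psi>_def [abs_def])
    then have "(LINT y:\<Omega>|lebesgue. u y *\<^sub>R grad (\<psi> i) y) = - (LINT y:\<Omega>|lebesgue. \<psi> i y *\<^sub>R Du y)"
      using u by (auto simp: in_W1p_loc_def has_weak_gradient_def)
    moreover have "\<psi> i y = 0" "grad (\<psi> i) y = 0" if "y \<notin> K" for y
      using sub that \<psi>0 grad_eq_0_outside[of x s "\<psi> i"] by blast+
    ultimately have "(\<integral>y. u y *\<^sub>R grad (\<psi> i) y \<partial>M) = - (\<integral>y. \<psi> i y *\<^sub>R Du y \<partial>M)"
      by (subst (asm) (1 2) set_integral_eq_integral_lebesgue_on[OF K_sets K_subset]) auto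
    then have "(\<integral>y. u y *\<^sub>R grad (\<psi> i) y \<partial>M) $ i = - (\<integral>y. \<psi> i y *\<^sub>R Du y \<partial>M) $ i"
      by simp
    then show ?thesis
      using integral_bounded_linear[OF bounded_linear_vec_nth[of i] int1[of i]]
        integral_bounded_linear[OF bounded_linear_vec_nth[of i] int3[of i]]
      by (simp add: grad_def)
  qed
  have intu: "integrable M (\<lambda>y. u y * partial_deriv i (\<psi> i) y)" for i
    using integrable_bounded_linear[OF bounded_linear_vec_nth[of i] int1[of i]] by (simp add: grad_def)
  have "(\<integral>y. u y * radial_div x s y \<partial>M) = (\<integral>y. (\<Sum>i\<in>UNIV. u y * partial_deriv i (\<psi> i) y) \<partial>M)"
    by (simp add: radial_div_eq \<psi>_def [abs_def] sum_distrib_left)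
  also have "\<dots> = (\<Sum>i\<in>UNIV. \<integral>y. u y * partial_deriv i (\<psi> i) y \<partial>M)"
    by (intro Bochner_Integration.integral_sum intu)
  also have "\<dots> = - (\<Sum>i\<in>UNIV. \<integral>y. Du y $ i * \<psi> i y \<partial>M)"
    by (simp add: comp sum_negf mult.commute)
  also have "(\<Sum>i\<in>UNIV. \<integral>y. Du y $ i * \<psi> i y \<partial>M) = (\<integral>y. (\<Sum>i\<in>UNIV. Du y $ i * \<psi> i y) \<partial>M)"
    by (intro Bochner_Integration.integral_sum[symmetric] int2)
  also have "\<dots> = (\<integral>y. cutoff x s y * ((y - x) \<bullet> Du y) \<partial>M)"
    by (simp add: \<psi>_def inner_vec_def sum_distrib_left mult_ac)
  finally show ?thesis .
qed

section \<open>Scaled averages of \<open>u\<close> and their growth at small scales\<close>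

definition mean :: "real ^ 'n \<Rightarrow> real \<Rightarrow> real"
  where "mean x s = (\<integral>y. u y * (s powr - real CARD('n) * cutoff x s y) \<partial>M)"

lemma mean_eq: "mean x s = s powr - real CARD('n) * (\<integral>y. u y * cutoff x s y \<partial>M)"
proof -
  have "mean x s = (\<integral>y. s powr - real CARD('n) * (u y * cutoff x s y) \<partial>M)"
    unfolding mean_def by (simp only: mult.left_commute)
  then show ?thesis
    by simp
qed

lemma mean_has_derivative:
  assumes s: "0 < s" and sub: "cball x s \<subseteq> K"
  shows "(mean x has_real_derivative
    s powr (- real CARD('n) - 1) * (\<integral>y. cutoff x s y * ((y - x) \<bullet> Du y) \<partial>M)) (at s)"
proof -
  let ?N = "real CARD('n)"
  have "((\<lambda>t. \<integral>y. u y * (t powr - ?N * cutoff x t y) \<partial>M) has_real_derivative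
      (\<integral>y. u y * - (s powr (- ?N - 1) * radial_div x s y) \<partial>M)) (at s)"
  \<comment> \<open>The interval stays away from 0, where t^(-N-1) is unbounded. For t > s the ball
    may leave \<open>K\<close>, which is harmless: integrability over \<open>K\<close> suffices
    there, and the divergence identity is used at \<open>s\<close> alone.\<close>
  proof (rule has_real_derivative_weighted_integral[where a = "s / 2" and b = "2 * s"
        and C = "(s / 2) powr (- ?N - 1) * (?N + 8)"])
    show "integrable M u"
      by (rule u_integrable)
    show "s \<in> {s / 2<..<2 * s}"
      using s by simp
    show "((\<lambda>t. t powr - ?N * cutoff x t y) has_real_derivative - (t powr (- ?N - 1) * radial_div x t y)) (at t)"
      if "t \<in> {s / 2<..<2 * s}" for t y
      using that s by (intro scaled_cutoff_has_derivative) auto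
    show "\<bar>- (t powr (- ?N - 1) * radial_div x t y)\<bar> \<le> (s / 2) powr (- ?N - 1) * (?N + 8)"
      if "t \<in> {s / 2<..<2 * s}" for t y
    proof -
      have "\<bar>- (t powr (- ?N - 1) * radial_div x t y)\<bar> = t powr (- ?N - 1) * \<bar>radial_div x t y\<bar>"
        by (simp add: abs_mult)
      also have "\<dots> \<le> (s / 2) powr (- ?N - 1) * (?N + 8)"
        using that s by (intro mult_mono powr_mono2' abs_radial_div_le) auto
      finally show ?thesis .
    qed
    show "integrable M (\<lambda>y. u y * (t powr - ?N * cutoff x t y))" for t
      by (intro integrable_on_compact_mult_continuous u_integrable compact_K
          continuous_on_mult continuous_on_const continuous_cutoff)
    show "(\<lambda>y. - (s powr (- ?N - 1) * radial_div x s y)) \<in> borel_measurable M"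
      using K_sets continuous_radial_div[of x s]
      by (intro continuous_imp_measurable_on_sets_lebesgue)
        (auto intro!: continuous_intros intro: continuous_on_subset)
  qed
  moreover have "(\<integral>y. u y * - (s powr (- ?N - 1) * radial_div x s y) \<partial>M) =
      s powr (- ?N - 1) * (\<integral>y. cutoff x s y * ((y - x) \<bullet> Du y) \<partial>M)"
  proof -
    have "(\<integral>y. u y * - (s powr (- ?N - 1) * radial_div x s y) \<partial>M) =
        (\<integral>y. - (s powr (- ?N - 1)) * (u y * radial_div x s y) \<partial>M)"
      by (rule Bochner_Integration.integral_cong) auto
    also have "\<dots> = - (s powr (- ?N - 1)) * (\<integral>y. u y * radial_div x s y \<partial>M)"
      by (rule integral_mult_right_zero)
    finally show ?thesis
      by (simp add: integral_radial_div[OF s sub])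
  qed
  ultimately show ?thesis
    unfolding mean_def [abs_def] by simp
qed

text \<open>A positive average is exactly the sign hypothesis of the flux estimate, and the powers
  of \<open>t\<close> combine to t^(-\<kappa>), so the comparison lemma applies. At the fixed scale
  \<open>b\<close> the kernel lies between 0 and 1, hence the integral of \<open>u\<close> against
  it is at most that of the positive part.\<close>

lemma mean_le:
  assumes s: "0 < s" "s \<le> b" and b: "b \<le> 1" and sub: "cball x b \<subseteq> K"
  shows "mean x s \<le> b powr - real CARD('n) * (\<integral>y. max (u y) 0 \<partial>M) + (V + energy_const) / (1 - \<kappa>)"
proof -
  let ?N = "real CARD('n)"
  have le: "cball x t \<subseteq> K" if "t \<le> b" for t
    using sub that by (meson order_trans subset_cball)
  have "mean x s \<le> max (mean x b) 0 + (V + energy_const) / (1 - \<kappa>) * b powr (1 - \<kappa>)"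
  proof (rule le_of_derivative_bound_while_positive[OF s])
    show "\<kappa> < 1" "0 \<le> V + energy_const"
      using \<kappa>_bounds V_pos energy_const_nonneg by auto
    show "(mean x has_real_derivative t powr (- ?N - 1) * (\<integral>y. cutoff x t y * ((y - x) \<bullet> Du y) \<partial>M)) (at t)"
      if "0 < t" "t \<le> b" for t
      using that by (intro mean_has_derivative le)
    show "\<bar>t powr (- ?N - 1) * (\<integral>y. cutoff x t y * ((y - x) \<bullet> Du y) \<partial>M)\<bar> \<le> (V + energy_const) * t powr - \<kappa>"
      if t: "0 < t" "t \<le> b" "0 < mean x t" for t
    proof -
      have "(\<integral>y. u y * cutoff x t y \<partial>M) \<ge> 0"
        using t by (simp add: mean_eq zero_less_mult_iff)
      then have "t powr (- ?N - 1) * \<bar>\<integral>y. cutoff x t y * ((y - x) \<bullet> Du y) \<partial>M\<bar> \<le>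
          t powr (- ?N - 1) * ((V + energy_const) * t powr (?N + 1 - \<kappa>))"
        using t b by (intro mult_left_mono radial_flux_estimate le) auto
      also have "\<dots> = (V + energy_const) * (t powr (- ?N - 1) * t powr (?N + 1 - \<kappa>))"
        by (simp only: mult.left_commute)
      also have "t powr (- ?N - 1) * t powr (?N + 1 - \<kappa>) = t powr - \<kappa>"
        by (simp flip: powr_add)
      finally show ?thesis
        by (simp add: abs_mult)
    qed
  qed
  also have "(V + energy_const) / (1 - \<kappa>) * b powr (1 - \<kappa>) \<le> (V + energy_const) / (1 - \<kappa>)"
    using s b \<kappa>_bounds V_pos energy_const_nonneg
    by (intro mult_left_le powr_le1) auto
  also have "max (mean x b) 0 \<le> b powr - ?N * (\<integral>y. max (u y) 0 \<partial>M)"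
  proof -
    have "(\<integral>y. u y * cutoff x b y \<partial>M) \<le> (\<integral>y. max (u y) 0 \<partial>M)"
    proof (rule integral_mono_AE')
      show "integrable M (\<lambda>y. max (u y) 0)"
        using u_integrable by auto
      show "AE y in M. u y * cutoff x b y \<le> max (u y) 0"
      proof (rule AE_I2)
        fix y
        show "u y * cutoff x b y \<le> max (u y) 0"
          using cutoff_nonneg[of x b y] cutoff_le_1[of x b y]
          by (cases "u y \<ge> 0") (auto intro: mult_left_le simp: mult_nonpos_nonneg)
      qed
    qed simp
    moreover have "(\<integral>y. max (u y) 0 \<partial>M) \<ge> 0"
      by (rule integral_nonneg_AE) simp
    ultimately show ?thesis
      unfolding mean_eq by (simp add: mult_left_mono)
  qed
  finally show ?thesis
    by simp
qed

text \<open>The averages are scaled by s^(-N), not by the mass of the kernel. That mass is at least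
  exp(-2) V (s/2)^N, which explains the last factor of \<open>C\<close>: with it, u - C has
  nonpositive integral against every small kernel centred in \<open>S\<close>.\<close>

lemma AE_le_bound:
  assumes b: "0 < b" "b \<le> 1" and S: "open S" "S \<subseteq> K" and sub: "\<And>x. x \<in> S \<Longrightarrow> cball x b \<subseteq> K"
    and C: "C = (b powr - real CARD('n) * (\<integral>y. max (u y) 0 \<partial>M) + (V + energy_const) / (1 - \<kappa>))
      * (exp 2 * 2 ^ CARD('n) / V)"
  shows "AE y in lebesgue. y \<in> S \<longrightarrow> u y \<le> C"
proof -
  define C0 where "C0 = b powr - real CARD('n) * (\<integral>y. max (u y) 0 \<partial>M) + (V + energy_const) / (1 - \<kappa>)"
  have C_eq: "C = C0 * (exp 2 * 2 ^ CARD('n) / V)"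
    by (simp only: C C0_def)
  have CC0: "C * (exp (- 2) * (V * (s / 2) ^ CARD('n))) = C0 * s ^ CARD('n)" for s :: real
    using V_pos by (simp add: C_eq power_divide exp_minus field_simps)
  have "0 \<le> (\<integral>y. max (u y) 0 \<partial>M)"
    by (rule integral_nonneg_AE) simp
  then have C0: "C0 \<ge> 0"
    using \<kappa>_bounds V_pos energy_const_nonneg by (simp add: C0_def)
  then have C_nonneg: "C \<ge> 0"
    using V_pos by (simp add: C_eq)
  \<comment> \<open>Extending by zero outside \<open>K\<close> makes the function integrable on the
    whole space; kernels centred in \<open>S\<close> with radius at most \<open>b\<close> do not see
    the change.\<close>
  define w where "w y = indicator K y * (u y - C)" for y
  define s where "s n = b / real (Suc n)" for n
  have s: "0 < s n" "s n \<le> b" for n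
    using b by (auto simp: s_def field_simps)
  have fin: "integrable M (\<lambda>y. C)"
  proof -
    have "emeasure M (space M) < \<infinity>"
      using compact_K K_sets emeasure_compact_finite[of K]
      by (simp add: emeasure_restrict_space space_restrict_space emeasure_completion borel_compact)
    then show ?thesis
      by (intro finite_measure.integrable_const finite_measureI) auto
  qed
  have w_int: "integrable lebesgue w"
  proof -
    have "integrable M (\<lambda>y. u y - C)"
      using u_integrable fin by auto
    then show ?thesis
      using K_sets by (simp add: integrable_restrict_space w_def [abs_def])
  qed
  have "AE y in lebesgue. y \<in> S \<longrightarrow> w y \<le> 0"
  proof (rule AE_nonpos_of_averages[OF w_int S(1), where k = "\<lambda>n. cutoff (0 :: real ^ 'n) (s n)" and r = s])
    show "continuous_on UNIV (cutoff (0 :: real ^ 'n) (s n))" for n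
      by (rule continuous_cutoff)
    show "0 \<le> cutoff (0 :: real ^ 'n) (s n) z" for n z
      by (rule cutoff_nonneg)
    show "cutoff (0 :: real ^ 'n) (s n) z = 0" if "s n \<le> norm z" for n z
      using cutoff_eq_0(1)[OF s(1), of n z 0] that by simp
    show "s \<longlonglongrightarrow> 0"
      unfolding s_def [abs_def] using LIMSEQ_Suc[OF lim_const_over_n[of b]] by simp
    show "(\<integral>z. cutoff (0 :: real ^ 'n) (s n) z \<partial>lebesgue) > 0" for n
    proof -
      have "0 < exp (- 2) * (unit_ball_vol (real CARD('n)) * (s n / 2) ^ CARD('n))"
        using s(1)[of n] by simp
      also have "\<dots> \<le> (\<integral>z. cutoff (0 :: real ^ 'n) (s n) z \<partial>lebesgue)"
        by (rule integral_cutoff_ge(2)[OF s(1)])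
      finally show ?thesis .
    qed
    show "(\<integral>y. w y * cutoff (0 :: real ^ 'n) (s n) (y - x) \<partial>lebesgue) \<le> 0" if x: "x \<in> S" for n x
    proof -
      let ?\<phi> = "cutoff x (s n)"
      have out: "?\<phi> y = 0" if "y \<notin> K" for y
        using cutoff_eq_0_outside[OF s(1)] sub[OF x] subset_cball[OF s(2)] that by blast
      have i1: "integrable M (\<lambda>y. u y * ?\<phi> y)" and i2: "integrable M (\<lambda>y. C * ?\<phi> y)"
        by (intro integrable_on_compact_mult_continuous u_integrable fin compact_K continuous_cutoff)+
      have "(\<integral>y. w y * cutoff (0 :: real ^ 'n) (s n) (y - x) \<partial>lebesgue) = (LINT y:UNIV|lebesgue. (u y - C) * ?\<phi> y)"
        unfolding set_lebesgue_integral_def cutoff_translate[symmetric]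
        by (rule Bochner_Integration.integral_cong) (auto simp: w_def indicator_def out)
      also have "\<dots> = (\<integral>y. (u y - C) * ?\<phi> y \<partial>M)"
        by (rule set_integral_eq_integral_lebesgue_on[OF K_sets]) (auto simp: out)
      also have "\<dots> = (\<integral>y. u y * ?\<phi> y \<partial>M) - (\<integral>y. C * ?\<phi> y \<partial>M)"
        using i1 i2 by (simp add: left_diff_distrib)
      also have "(\<integral>y. u y * ?\<phi> y \<partial>M) \<le> C0 * s n ^ CARD('n)"
      proof -
        have "mean x (s n) \<le> C0"
          unfolding C0_def using s[of n] b by (intro mean_le sub[OF x])
        then have "s n powr real CARD('n) * mean x (s n) \<le> s n powr real CARD('n) * C0"
          by (rule mult_left_mono) simp
        moreover have "s n powr real CARD('n) * mean x (s n) = (\<integral>y. u y * ?\<phi> y \<partial>M)"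
          using s(1)[of n] unfolding mean_eq by (simp flip: mult.assoc powr_add)
        ultimately show ?thesis
          using powr_realpow[OF s(1)[of n]] by (simp add: mult.commute)
      qed
      also have "(\<integral>y. C * ?\<phi> y \<partial>M) \<ge> C0 * s n ^ CARD('n)"
      proof -
        have "(\<integral>y. ?\<phi> y \<partial>lebesgue) = (\<integral>y. ?\<phi> y \<partial>M)"
          using set_integral_eq_integral_lebesgue_on[OF K_sets subset_UNIV, of ?\<phi>] out
          by (simp add: set_lebesgue_integral_def)
        moreover have "C * (exp (- 2) * (V * (s n / 2) ^ CARD('n))) \<le> C * (\<integral>y. ?\<phi> y \<partial>lebesgue)"
          using integral_cutoff_ge(2)[OF s(1)] C_nonneg by (intro mult_left_mono) (auto simp: V_def)
        ultimately show ?thesis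
          by (simp add: CC0)
      qed
      finally show ?thesis
        by simp
    qed
  qed
  then show ?thesis
    by (rule AE_mp) (use S(2) in \<open>auto intro!: AE_I2 simp: w_def\<close>)
qed

end

section \<open>The local bound\<close>

text \<open>The constant of \<open>AE_le_bound\<close> at scale b = min 1 ((R - \<rho>)/4), with the
  integrals of |f|^q and of the positive part over \<open>K\<close> replaced by
  \<open>F powr q\<close> and \<open>U\<close>, the data on the large ball.\<close>

definition sup_const :: "nat \<Rightarrow> real \<Rightarrow> real \<Rightarrow> real \<Rightarrow> real \<Rightarrow> real \<Rightarrow> real \<Rightarrow> real \<Rightarrow> real"
  where "sup_const N \<beta> p q \<rho> R F U =
    (min 1 ((R - \<rho>) / 4) powr - real N * U
      + (unit_ball_vol (real N)
          + 2 * (2 * unit_ball_vol (real N) + F powr q + 128 * \<beta>\<^sup>2 * unit_ball_vol (real N)))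
        / (1 - max (real N / q) 2 / p))
    * (exp 2 * 2 ^ N / unit_ball_vol (real N))"

lemma Lp_norm_subset_finite:
  assumes fin: "Lp_norm q T g < top" and ST: "S \<subseteq> T" "S \<in> sets lebesgue" "T \<in> sets lebesgue"
    and le: "\<And>x. norm (f x) \<le> norm (g x)" and q: "q > 0"
  shows "Lp_norm q S f < top"
proof -
  have "(\<integral>\<^sup>+ x. ennreal (norm (f x) powr q) \<partial>lebesgue_on S)
      \<le> (\<integral>\<^sup>+ x. ennreal (norm (g x) powr q) \<partial>lebesgue_on T)"
    using ST le q by (subst (1 2) nn_integral_restrict_space)
      (auto intro!: nn_integral_mono ennreal_leI powr_mono2 simp: indicator_def)
  also have "\<dots> < top"
    using fin by (simp add: Lp_norm_finite_iff)
  finally show ?thesis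
    by (simp add: Lp_norm_finite_iff)
qed

lemma norm_pos_part_le: "norm (pos_part u x) \<le> norm (u x)"
  by (simp add: pos_part_def)

lemma pos_part_measurable:
  assumes "u \<in> borel_measurable M"
  shows "pos_part u \<in> borel_measurable M"
  using assms unfolding pos_part_def [abs_def] by simp

lemma Linf_norm_pos_part_le:
  fixes \<Omega> :: "(real ^ 'n::finite) set"
  assumes \<Omega>: "open \<Omega>" and \<beta>: "\<beta> > 0"
    and growth: "AE x in lebesgue_on \<Omega>. \<forall>s \<xi>. norm (a x s \<xi>) \<le> \<beta> * (1 + norm \<xi>)"
    and p: "p > 2" and lam: "lam > 0" and q: "q \<ge> 1" "q > real CARD('n) / p"
    and f: "f \<in> Lp_loc q \<Omega>" and u: "in_W1p_loc p \<Omega> u Du"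
    and subsolution: "distr_subsolution \<Omega> a lam p f u Du"
    and \<rho>: "0 < \<rho>" "\<rho> < R" and ball: "ball z R \<subseteq> \<Omega>"
    and fin: "Lp_norm q (ball z R) f < top" "Lp_norm 1 (ball z R) (pos_part u) < top"
  shows "Linf_norm (ball z \<rho>) (pos_part u) \<le> ennreal (sup_const CARD('n) \<beta> p q \<rho> R
    (enn2real (Lp_norm q (ball z R) f)) (enn2real (Lp_norm 1 (ball z R) (pos_part u))))"
proof -
  \<comment> \<open>The intermediate radius makes \<open>K\<close> compact inside the open ball of
    radius \<open>R\<close>, and leaves a margin (R - \<rho>)/2 for the small balls centred in the
    inner one.\<close>
  define K where "K = cball z ((\<rho> + R) / 2)"
  define V where "V \<equiv> unit_ball_vol (real CARD('n))"
  have KR: "K \<subseteq> ball z R"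
    using \<rho> by (auto simp: K_def)
  interpret local_subsolution \<Omega> K a \<beta> p q lam f u Du V
  proof unfold_locales
    show "compact K"
      by (simp add: K_def)
    show "K \<subseteq> \<Omega>"
      using KR ball by blast
  qed (fact V_def \<Omega> \<beta> growth p lam q f u subsolution)+
  define b where "b = min 1 ((R - \<rho>) / 4)"
  have b: "0 < b" "b \<le> 1" "b \<le> (R - \<rho>) / 4"
    using \<rho> min.cobounded2[of 1 "(R - \<rho>) / 4"] by (simp_all only: b_def) auto
  define F where "F = enn2real (Lp_norm q (ball z R) f)"
  define U where "U = enn2real (Lp_norm 1 (ball z R) (pos_part u))"
  have meas: "pos_part u \<in> borel_measurable (lebesgue_on (ball z \<rho>))"
  proof (rule pos_part_measurable, rule Lp_loc_measurable_on)
    show "u \<in> Lp_loc p \<Omega>"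
      using u by (simp add: in_W1p_loc_def)
    show "ball z \<rho> \<subseteq> \<Omega>"
      using ball \<rho> subset_ball[of \<rho> R z] by auto
  qed
  have Fle: "(\<integral>y. \<bar>f y\<bar> powr q \<partial>lebesgue_on K) \<le> F powr q"
    using integral_powr_le_Lp_norm[OF _ _ KR _ K_sets, of q f] fin(1) q by (simp add: F_def)
  have Ule: "(\<integral>y. max (u y) 0 \<partial>lebesgue_on K) \<le> U"
    using integral_powr_le_Lp_norm[OF _ _ KR _ K_sets, of 1 "pos_part u"] fin(2)
    by (simp add: U_def pos_part_def)
  define C where "C = (b powr - real CARD('n) * (\<integral>y. max (u y) 0 \<partial>lebesgue_on K) + (V + energy_const) / (1 - \<kappa>))
      * (exp 2 * 2 ^ CARD('n) / V)"
  have "AE y in lebesgue. y \<in> ball z \<rho> \<longrightarrow> u y \<le> C"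
  proof (rule AE_le_bound[OF b(1,2) _ _ _ C_def])
    show "ball z \<rho> \<subseteq> K"
      using \<rho> by (auto simp: K_def)
    show "cball x b \<subseteq> K" if "x \<in> ball z \<rho>" for x
    proof
      fix y
      assume "y \<in> cball x b"
      then have "dist z y \<le> dist z x + b"
        using dist_triangle[of z y x] by simp
      then show "y \<in> K"
        using that b(3) \<rho> by (simp add: K_def)
    qed
  qed simp
  moreover have C_le: "C \<le> sup_const CARD('n) \<beta> p q \<rho> R F U"
    unfolding C_def sup_const_def V_def[symmetric] b_def[symmetric] \<kappa>_def[symmetric] energy_const_def
    using Fle Ule V_pos \<kappa>_bounds
    by (intro mult_right_mono add_mono mult_left_mono divide_right_mono) auto
  \<comment> \<open>Nonnegativity is what upgrades a bound for \<open>u\<close> to the same bound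
    for its positive part.\<close>
  moreover have "0 \<le> C"
  proof -
    have "0 \<le> (\<integral>y. max (u y) 0 \<partial>lebesgue_on K)"
      by (rule integral_nonneg_AE) simp
    then show ?thesis
      unfolding C_def using V_pos \<kappa>_bounds energy_const_nonneg
      by (intro mult_nonneg_nonneg add_nonneg_nonneg divide_nonneg_nonneg) auto
  qed
  ultimately have "AE y in lebesgue. y \<in> ball z \<rho> \<longrightarrow> norm (pos_part u y) \<le> sup_const CARD('n) \<beta> p q \<rho> R F U"
    by (auto elim!: eventually_mono simp: pos_part_def)
  then have "AE y in lebesgue_on (ball z \<rho>).
      ennreal (norm (pos_part u y)) \<le> ennreal (sup_const CARD('n) \<beta> p q \<rho> R F U)"
    by (subst AE_restrict_space_iff) (auto elim!: eventually_mono intro: ennreal_leI)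
  then show ?thesis
    unfolding Linf_norm_def F_def U_def using meas by (intro esssup_I) auto
qed

text \<open>A finite subcover of the compact set suffices; the sum of the finitely many local bounds
  serves as a common bound.\<close>

lemma Linf_loc_of_local_bound:
  fixes v :: "'a::euclidean_space \<Rightarrow> 'b::euclidean_space"
  assumes meas: "v \<in> borel_measurable (lebesgue_on \<Omega>)"
    and loc: "\<And>z. z \<in> \<Omega> \<Longrightarrow> \<exists>r>0. Linf_norm (ball z r) v < top"
  shows "v \<in> Linf_loc \<Omega>"
  unfolding Linf_loc_def
proof (intro CollectI conjI allI impI meas)
  fix C
  assume "compact C \<and> C \<subseteq> \<Omega>"
  then have C: "compact C" "C \<subseteq> \<Omega>"
    by auto
  obtain r where r: "\<And>z. z \<in> C \<Longrightarrow> r z > 0" "\<And>z. z \<in> C \<Longrightarrow> Linf_norm (ball z (r z)) v < top"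
    using loc C(2) by (metis subsetD)
  obtain D where D: "D \<subseteq> C" "finite D" "C \<subseteq> (\<Union>z\<in>D. ball z (r z))"
    by (rule compactE_image[OF C(1), of C "\<lambda>z. ball z (r z)"]) (use r(1) in \<open>auto intro: centre_in_ball[THEN iffD2]\<close>)
  define L where "L z = Linf_norm (ball z (r z)) v" for z
  have "AE x in lebesgue. x \<in> ball z (r z) \<longrightarrow> ennreal (norm (v x)) \<le> L z" for z
    using esssup_AE[of "\<lambda>x. ennreal (norm (v x))" "lebesgue_on (ball z (r z))"]
    by (subst (asm) AE_restrict_space_iff) (auto simp: L_def Linf_norm_def)
  then have "AE x in lebesgue. \<forall>z\<in>D. x \<in> ball z (r z) \<longrightarrow> ennreal (norm (v x)) \<le> L z"
    using D(2) by (intro AE_finite_allI) auto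
  then have "AE x in lebesgue. x \<in> C \<longrightarrow> ennreal (norm (v x)) \<le> (\<Sum>z\<in>D. L z)"
  proof eventually_elim
    fix x
    assume x: "\<forall>z\<in>D. x \<in> ball z (r z) \<longrightarrow> ennreal (norm (v x)) \<le> L z"
    show "x \<in> C \<longrightarrow> ennreal (norm (v x)) \<le> (\<Sum>z\<in>D. L z)"
    proof
      assume "x \<in> C"
      then obtain z where z: "z \<in> D" "x \<in> ball z (r z)"
        using D(3) by blast
      then have "ennreal (norm (v x)) \<le> L z"
        using x by blast
      also have "\<dots> \<le> (\<Sum>z\<in>D. L z)"
        using z D(2) by (intro member_le_sum) auto
      finally show "ennreal (norm (v x)) \<le> (\<Sum>z\<in>D. L z)" .
    qed
  qed
  moreover have "C \<in> sets lebesgue"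
    by (intro fmeasurableD lmeasurable_compact C(1))
  ultimately have "AE x in lebesgue_on C. ennreal (norm (v x)) \<le> (\<Sum>z\<in>D. L z)"
    by (subst AE_restrict_space_iff) auto
  moreover have "v \<in> borel_measurable (lebesgue_on C)"
    by (rule measurable_restrict_mono[OF meas C(2)])
  ultimately have "Linf_norm C v \<le> (\<Sum>z\<in>D. L z)"
    unfolding Linf_norm_def by (intro esssup_I) auto
  also have "\<dots> < top"
    using D(1,2) r(2) by (auto simp: L_def)
  finally show "Linf_norm C v < \<infinity>"
    by simp
qed

theorem theorem4p2:
  "\<exists>K :: real \<Rightarrow> real \<Rightarrow> real \<Rightarrow> real \<Rightarrow> real \<Rightarrow> real \<Rightarrow> ennreal \<Rightarrow> ennreal \<Rightarrow> ennreal.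
    (\<forall>\<beta> p q l \<rho> R F U. F < \<infinity> \<and> U < \<infinity> \<longrightarrow> K \<beta> p q l \<rho> R F U < \<infinity>) \<and>
    (\<forall>(\<Omega> :: (real ^ 'n::finite) set) (a :: real ^ 'n \<Rightarrow> real \<Rightarrow> real ^ 'n \<Rightarrow> real ^ 'n)
      (\<beta> :: real) (p :: real) (lam :: real) (q :: real)
      (f :: real ^ 'n \<Rightarrow> real) (u :: real ^ 'n \<Rightarrow> real) (Du :: real ^ 'n \<Rightarrow> real ^ 'n).
      bounded \<Omega> \<and> open \<Omega> \<and>
      caratheodory \<Omega> a \<and>
      \<beta> > 0 \<and>
      (AE x in lebesgue_on \<Omega>. \<forall>s \<xi>. norm (a x s \<xi>) \<le> \<beta> * (1 + norm \<xi>)) \<and>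
      p > 2 \<and> lam > 0 \<and>
      q \<ge> 1 \<and> q > real CARD('n) / p \<and>
      f \<in> Lp_loc q \<Omega> \<and>
      in_W1p_loc p \<Omega> u Du \<and>
      distr_subsolution \<Omega> a lam p f u Du
      \<longrightarrow>
      pos_part u \<in> Linf_loc \<Omega> \<and>
      (\<forall>z \<rho> R. 0 < \<rho> \<and> \<rho> < R \<and> ball z R \<subseteq> \<Omega> \<longrightarrow>
        Linf_norm (ball z \<rho>) (pos_part u)
          \<le> K \<beta> p q (inverse lam) \<rho> R
              (Lp_norm q (ball z R) f) (Lp_norm 1 (ball z R) (pos_part u))))"
proof -
  \<comment> \<open>The ball of radius \<open>R\<close> may touch the boundary of \<Omega>, where
    local integrability does not make the two norms finite. In that case the value
    \<open>top\<close> makes the estimate trivial.\<close>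
  define K where "K \<beta> p q l \<rho> R F U = (if F < top \<and> U < top
      then ennreal (sup_const CARD('n) \<beta> p q \<rho> R (enn2real F) (enn2real U)) else top)"
    for \<beta> p q l \<rho> R :: real and F U :: ennreal
  show ?thesis
  proof (intro exI[of _ K] conjI allI impI; (elim conjE)?)
    fix \<beta> p q l \<rho> R :: real and F U :: ennreal
    assume "F < \<infinity>" "U < \<infinity>"
    then show "K \<beta> p q l \<rho> R F U < \<infinity>"
      by (simp add: K_def)
  next
    fix \<Omega> :: "(real ^ 'n) set" and a :: "real ^ 'n \<Rightarrow> real \<Rightarrow> real ^ 'n \<Rightarrow> real ^ 'n"
      and \<beta> p lam q :: real and f u :: "real ^ 'n \<Rightarrow> real" and Du :: "real ^ 'n \<Rightarrow> real ^ 'n"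
      and z :: "real ^ 'n" and \<rho> R :: real
    assume H: "open \<Omega>" "0 < \<beta>" "AE x in lebesgue_on \<Omega>. \<forall>s \<xi>. norm (a x s \<xi>) \<le> \<beta> * (1 + norm \<xi>)"
      "2 < p" "0 < lam" "1 \<le> q" "real CARD('n) / p < q" "f \<in> Lp_loc q \<Omega>" "in_W1p_loc p \<Omega> u Du"
      "distr_subsolution \<Omega> a lam p f u Du" "0 < \<rho>" "\<rho> < R" "ball z R \<subseteq> \<Omega>"
    show "Linf_norm (ball z \<rho>) (pos_part u) \<le> K \<beta> p q (inverse lam) \<rho> R
        (Lp_norm q (ball z R) f) (Lp_norm 1 (ball z R) (pos_part u))"
      using Linf_norm_pos_part_le[OF H] by (auto simp: K_def)
  next
    fix \<Omega> :: "(real ^ 'n) set" and a :: "real ^ 'n \<Rightarrow> real \<Rightarrow> real ^ 'n \<Rightarrow> real ^ 'n"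
      and \<beta> p lam q :: real and f u :: "real ^ 'n \<Rightarrow> real" and Du :: "real ^ 'n \<Rightarrow> real ^ 'n"
    assume H: "open \<Omega>" "0 < \<beta>" "AE x in lebesgue_on \<Omega>. \<forall>s \<xi>. norm (a x s \<xi>) \<le> \<beta> * (1 + norm \<xi>)"
      "2 < p" "0 < lam" "1 \<le> q" "real CARD('n) / p < q" "f \<in> Lp_loc q \<Omega>" "in_W1p_loc p \<Omega> u Du"
      "distr_subsolution \<Omega> a lam p f u Du"
    show "pos_part u \<in> Linf_loc \<Omega>"
    proof (rule Linf_loc_of_local_bound)
      have u: "u \<in> Lp_loc 1 \<Omega>"
        using H(9) by (simp add: in_W1p_loc_def has_weak_gradient_def)
      then show "pos_part u \<in> borel_measurable (lebesgue_on \<Omega>)"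
        by (intro pos_part_measurable) (simp add: Lp_loc_def)
      fix z
      assume "z \<in> \<Omega>"
      \<comment> \<open>The closed ball is compact in \<Omega>, so both norms on the open ball are
        finite and the quantitative bound with \<rho> = R/2 is a genuine one.\<close>
      then obtain R where R: "R > 0" "cball z R \<subseteq> \<Omega>"
        using H(1) open_contains_cball by blast
      have sets: "ball z R \<subseteq> cball z R" "ball z R \<in> sets lebesgue" "cball z R \<in> sets lebesgue"
        by auto
      have "Lp_norm q (cball z R) f < top" "Lp_norm 1 (cball z R) u < top"
        using H(8) u R(2) by (simp_all add: Lp_loc_def)
      then have fin: "Lp_norm q (ball z R) f < top" "Lp_norm 1 (ball z R) (pos_part u) < top"
        using H(6) by (auto intro!: Lp_norm_subset_finite[OF _ sets] norm_pos_part_le)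
      have "0 < R / 2" "R / 2 < R" "ball z R \<subseteq> \<Omega>"
        using R ball_subset_cball[of z R] by auto
      from Linf_norm_pos_part_le[OF H this fin] have "Linf_norm (ball z (R / 2)) (pos_part u) < top"
        by (rule order_le_less_trans) simp
      then show "\<exists>r>0. Linf_norm (ball z r) (pos_part u) < top"
        using R(1) half_gt_zero by blast
    qed
  qed
qed

end
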